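(* Let $0<p_1,p_2,q_1,q_2<\infty$, $p_1=q_1$, $p_2\ne q_2$ and $p_2\le p_1$. Let $v_1,v_2\in\mathcal W(0,\infty)$, $u_1\in{}^{\mathbf c}\Omega_{q_1}$ and $u_2\in\Omega_{q_2}$, and put $v(x)=v_1(x)^{-1}v_2(x)$. (i) If $p_1\le q_2$, then $$\|\mathrm I\|_{\mathrm{Cop}_{p_1,q_1}(u_1,v_1)\to\mathrm{Ces}_{p_2,q_2}(u_2,v_2)}\approx\sup_{t\in(0,\infty)}\Big\|\,\|u_1\|_{p_1,(0,\cdot)}^{-1}\Big\|_{p_1\to p_2,v,(0,t)}\|u_2\|_{q_2,(t,\infty)}.$$ (ii) If $q_2<p_1$, then $$\|\mathrm I\|_{\mathrm{Cop}_{p_1,q_1}(u_1,v_1)\to\mathrm{Ces}_{p_2,q_2}(u_2,v_2)}\approx\bigg(\int_{(0,\infty)}\Big\|\,\|u_1\|_{p_1,(0,\cdot)}^{-1}\Big\|_{p_1\to p_2,v,(0,t)}^{p_1\to q_2}\,d\Big(-\|u_2\|_{q_2,(t,\infty)}^{p_1\to q_2}\Big)\bigg)^{\frac1{p_1\to q_2}}.$$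
   Context: $\mathfrak M^+(0,\infty)$ is the set of non-negative measurable functions on $(0,\infty)$; $\mathcal W(0,\infty)$ is the set of weights (measurable functions, positive and finite a.e. on $(0,\infty)$). For $0<p\le\infty$ and measurable $A\subseteq(0,\infty)$, $\|f\|_{p,A}=(\int_A|f|^p\,dx)^{1/p}$ if $p<\infty$, $\|f\|_{\infty,A}=\operatorname{ess\,sup}_A|f|$, and $\|f\|_{p,w,A}=\|fw\|_{p,A}$. Conventions: $0/0=0$, $0\cdot(\pm\infty)=0$, $1/(\pm\infty)=0$. For $u\in\mathfrak M^+(0,\infty)$, $v\in\mathcal W(0,\infty)$ and $0<p,q\le\infty$, $\mathrm{Ces}_{p,q}(u,v)$ and $\mathrm{Cop}_{p,q}(u,v)$ are the sets of $f\in\mathfrak M^+(0,\infty)$ with finite $\|f\|_{\mathrm{Ces}_{p,q}(u,v)}=\big\|\,\|f\|_{p,v,(0,\cdot)}\big\|_{q,u,(0,\infty)}$, respectively $\|f\|_{\mathrm{Cop}_{p,q}(u,v)}=\big\|\,\|f\|_{p,v,(\cdot,\infty)}\big\|_{q,u,(0,\infty)}$. $\Omega_q$ is the set of $u\in\mathfrak M^+(0,\infty)$ with $0<\|u\|_{q,(t,\infty)}<\infty$ for all $t>0$; ${}^{\mathbf c}\Omega_q$ is the set of $u\in\mathfrak M^+(0,\infty)$ with $0<\|u\|_{q,(0,t)}<\infty$ for all $t>0$. $\|\mathrm I\|_{X\to Y}$ is the best constant of the embedding $X\hookrightarrow Y$: the least $c\in[0,\infty]$ with $\|f\|_Y\le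 c\|f\|_X$ for all $f\in X$. For $0<p,q\le\infty$, $p\to q$ denotes the number given by $\frac1{p\to q}=\frac1q-\frac1p$ if $q<p$, and $p\to q=\infty$ if $q\ge p$. For non-decreasing $h$ on $(0,\infty)$, $\int f\,dh$ is the Lebesgue–Stieltjes integral. $A\approx B$ means $c^{-1}B\le A\le cB$ with a constant $c>0$ depending only on $p_1,p_2,q_1,q_2$. *)

theory Defs
  imports "HOL-Analysis.Analysis" "HOL-Probability.Essential_Supremum"
begin

text \<open>
  Non-negative functions on \<open>(0,\<infinity>)\<close> are functions \<open>real \<Rightarrow> ennreal\<close> of which only the
  values on \<open>{0<..}\<close> matter; the value \<open>\<infinity>\<close> is allowed. The arithmetic of \<^typ>\<open>ennreal\<close>
  agrees with the conventions \<open>0/0 = 0\<close>, \<open>0 * \<infinity> = 0\<close>, \<open>1/\<infinity> = 0\<close>, and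
  \<open>inverse 0 = \<infinity>\<close>. Exponents range over \<^typ>\<open>ennreal\<close> as well, since \<open>\<infinity>\<close> is admitted.
\<close>

definition pos_meas :: "(real \<Rightarrow> ennreal) set"
  where "pos_meas = borel_measurable (lebesgue_on {0<..})"

definition weights :: "(real \<Rightarrow> ennreal) set"
  where "weights = {w \<in> pos_meas. AE x in lebesgue_on {0<..}. 0 < w x \<and> w x < \<infinity>}"

text \<open>Real powers on \<open>[0,\<infinity>]\<close>; intended for exponents \<open>a > 0\<close> only.\<close>

definition enn_powr :: "ennreal \<Rightarrow> real \<Rightarrow> ennreal"  (infixr "epowr" 80)
  where "x epowr a = (if x = \<infinity> then \<infinity> else ennreal (enn2real x powr a))"

definition Lnorm :: "ennreal \<Rightarrow> real set \<Rightarrow> (real \<Rightarrow> ennreal) \<Rightarrow> ennreal"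
  where "Lnorm p A f =
    (if p = \<infinity> then esssup (lebesgue_on A) f
     else (\<integral>\<^sup>+x. f x epowr enn2real p \<partial>lebesgue_on A) epowr (1 / enn2real p))"

definition Lnorm_w :: "ennreal \<Rightarrow> (real \<Rightarrow> ennreal) \<Rightarrow> real set \<Rightarrow> (real \<Rightarrow> ennreal) \<Rightarrow> ennreal"
  where "Lnorm_w p w A f = Lnorm p A (\<lambda>x. f x * w x)"

definition Ces_norm ::
    "ennreal \<Rightarrow> ennreal \<Rightarrow> (real \<Rightarrow> ennreal) \<Rightarrow> (real \<Rightarrow> ennreal) \<Rightarrow> (real \<Rightarrow> ennreal) \<Rightarrow> ennreal"
  where "Ces_norm p q u v f = Lnorm_w q u {0<..} (\<lambda>t. Lnorm_w p v {0<..<t} f)"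

definition Cop_norm ::
    "ennreal \<Rightarrow> ennreal \<Rightarrow> (real \<Rightarrow> ennreal) \<Rightarrow> (real \<Rightarrow> ennreal) \<Rightarrow> (real \<Rightarrow> ennreal) \<Rightarrow> ennreal"
  where "Cop_norm p q u v f = Lnorm_w q u {0<..} (\<lambda>t. Lnorm_w p v {t<..} f)"

definition Cop ::
    "ennreal \<Rightarrow> ennreal \<Rightarrow> (real \<Rightarrow> ennreal) \<Rightarrow> (real \<Rightarrow> ennreal) \<Rightarrow> (real \<Rightarrow> ennreal) set"
  where "Cop p q u v = {f \<in> pos_meas. Cop_norm p q u v f < \<infinity>}"

definition Omega :: "ennreal \<Rightarrow> (real \<Rightarrow> ennreal) set"
  where "Omega q = {u \<in> pos_meas. \<forall>t>0. 0 < Lnorm q {t<..} u \<and> Lnorm q {t<..} u < \<infinity>}"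

definition cOmega :: "ennreal \<Rightarrow> (real \<Rightarrow> ennreal) set"
  where "cOmega q = {u \<in> pos_meas. \<forall>t>0. 0 < Lnorm q {0<..<t} u \<and> Lnorm q {0<..<t} u < \<infinity>}"

text \<open>
  Least \<open>c \<in> [0,\<infinity>]\<close> with \<open>\<parallel>f\<parallel>\<^sub>Y \<le> c \<parallel>f\<parallel>\<^sub>X\<close> for all \<open>f \<in> X\<close>. If the infimum is finite it is
  attained; it is \<open>\<infinity>\<close> if no finite constant is admissible. Membership \<open>f \<in> Y\<close> need not
  be required separately: for \<open>c < \<infinity>\<close> the inequality forces \<open>\<parallel>f\<parallel>\<^sub>Y < \<infinity>\<close>.
\<close>

definition best_const ::
    "'a set \<Rightarrow> ('a \<Rightarrow> ennreal) \<Rightarrow> ('a \<Rightarrow> ennreal) \<Rightarrow> ennreal"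
  where "best_const X normX normY = Inf {c. \<forall>f\<in>X. normY f \<le> c * normX f}"

definition arrow :: "ennreal \<Rightarrow> ennreal \<Rightarrow> ennreal"  (infix "\<leadsto>" 70)
  where "p \<leadsto> q = (if q < p then inverse (inverse q - inverse p) else \<infinity>)"

definition approx_by :: "real \<Rightarrow> ennreal \<Rightarrow> ennreal \<Rightarrow> bool"
  where "approx_by c A B \<longleftrightarrow> inverse (ennreal c) * B \<le> A \<and> A \<le> ennreal c * B"

text \<open>
  Lebesgue--Stieltjes measure on \<open>(0,\<infinity>)\<close> of a non-decreasing \<open>h\<close>: the Borel measure with
  \<open>\<mu>(a,b] = h(b+) - h(a+)\<close> for \<open>0 < a \<le> b\<close>. The library's \<^const>\<open>interval_measure\<close> needs a
  function on all of \<open>\<real>\<close>, whereas here \<open>h\<close> may tend to \<open>-\<infinity>\<close> at \<open>0\<close>.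
\<close>

definition stieltjes :: "(real \<Rightarrow> real) \<Rightarrow> real measure"
  where "stieltjes h =
    extend_measure {0<..} {(a, b). 0 < a \<and> a \<le> b} (\<lambda>(a, b). {a<..b})
      (\<lambda>(a, b). ennreal (Lim (at_right b) h - Lim (at_right a) h))"

lemma mono_tendsto_at_right:
  fixes h :: "real \<Rightarrow> real"
  assumes "mono_on {0<..} h" "0 < a"
  shows "(h \<longlongrightarrow> Inf (h ` {a<..})) (at_right a)"
proof -
  have "{a<..} \<inter> {0<..} = {a<..}" using assms(2) by auto
  moreover have "(h \<longlongrightarrow> Inf (h ` ({a<..} \<inter> {0<..}))) (at a within ({a<..} \<inter> {0<..}))"
    using assms by (intro Lim_right_bound[where K = "h a"]) (auto simp: mono_on_def)
  ultimately show ?thesis by simp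
qed

lemma Lim_at_right_mono:
  fixes h :: "real \<Rightarrow> real"
  assumes "mono_on {0<..} h" "0 < a"
  shows "Lim (at_right a) h = Inf (h ` {a<..})"
  using mono_tendsto_at_right[OF assms] by (intro tendsto_Lim) auto

lemma emeasure_stieltjes_Ioc:
  fixes h :: "real \<Rightarrow> real"
  assumes h: "mono_on {0<..} h" and ab: "0 < a" "a \<le> b"
  shows "emeasure (stieltjes h) {a<..b} = ennreal (Lim (at_right b) h - Lim (at_right a) h)"
proof -
  define G where "G = (\<lambda>a. Inf (h ` {a<..}))"
  define F where "F = (\<lambda>s. G (exp s))"
  have bdd: "bdd_below (h ` {x<..})" if "0 < x" for x
    using h that by (intro bdd_belowI2[where m = "h x"]) (auto simp: mono_on_def)
  have G_mono: "G x \<le> G y" if "0 < x" "x \<le> y" for x y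
    unfolding G_def using that by (intro cInf_superset_mono bdd) auto
  have G_le: "G x \<le> h y" if "0 < x" "x < y" for x y
    unfolding G_def using that by (intro cInf_lower bdd) auto
  have G_right: "(G \<longlongrightarrow> G x) (at_right x)" if x: "0 < x" for x
  proof (rule order_tendstoI)
    fix l assume "l < G x"
    then show "eventually (\<lambda>y. l < G y) (at_right x)"
      unfolding eventually_at_right_field using G_mono[OF x]
      by (intro exI[of _ "x + 1"]) (force intro: less_le_trans)
  next
    fix l assume "G x < l"
    then obtain z where z: "x < z" "h z < l"
      unfolding G_def by (subst (asm) cInf_less_iff) (use bdd x in auto)
    have "G y < l" if "x < y" "y < z" for y
      using G_le[of y z] that x z by linarith
    then show "eventually (\<lambda>y. G y < l) (at_right x)"
      unfolding eventually_at_right_field using z by auto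
  qed
  have F_mono: "F x \<le> F y" if "x \<le> y" for x y
    unfolding F_def using that by (intro G_mono) auto
  have F_right: "continuous (at_right s) F" for s
  proof -
    have "filterlim exp (at_right (exp s)) (at_right s)"
      unfolding filterlim_at
      by (auto simp: eventually_at_filter intro!: tendsto_intros)
    from filterlim_compose[OF G_right this] show ?thesis
      by (simp add: continuous_within F_def)
  qed
  define N where "N = distr (interval_measure F) borel exp"
  have N_sets: "sets N = sets borel" by (simp add: N_def)
  have exp_meas: "exp \<in> measurable (interval_measure F) (borel :: real measure)"
    by (auto intro!: borel_measurable_continuous_onI continuous_intros)
  have N_eq: "emeasure N {x<..y} = ennreal (Lim (at_right y) h - Lim (at_right x) h)"
    if "0 < x \<and> x \<le> y" for x y
  proof -
    have "exp -` {x<..y} = {ln x<..ln y}"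
      using that ln_less_cancel_iff[of x] by (auto simp: ln_ge_iff less_le_trans)
        (metis exp_less_cancel_iff exp_ln less_eq_real_def)+
    then have "emeasure N {x<..y} = emeasure (interval_measure F) {ln x<..ln y}"
      unfolding N_def by (subst emeasure_distr[OF exp_meas]) auto
    also have "\<dots> = ennreal (F (ln y) - F (ln x))"
      using that by (intro emeasure_interval_measure_Ioc F_mono F_right) auto
    finally show ?thesis
      using that by (simp add: F_def G_def Lim_at_right_mono[OF h])
  qed
  let ?I = "{(a, b). 0 < a \<and> a \<le> (b::real)}"
  have sub: "(\<lambda>(a, b). {a<..b}) ` ?I \<subseteq> Pow {0<..}" by auto
  have "sets (stieltjes h) = sigma_sets {0<..} ((\<lambda>(a, b). {a<..b}) ` ?I)"
    unfolding stieltjes_def by (rule sets_extend_measure[OF sub])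
  also have "\<dots> \<subseteq> sets borel"
  proof
    fix X :: "real set" assume "X \<in> sigma_sets {0<..} ((\<lambda>(a, b). {a<..b}) ` ?I)"
    then show "X \<in> sets borel" by induction auto
  qed
  finally have sets_sub: "sets (stieltjes h) \<subseteq> sets N" by (simp add: N_sets)
  have "countably_additive (sets (stieltjes h)) (emeasure N)"
    unfolding countably_additive_def
  proof (intro allI impI)
    fix A :: "nat \<Rightarrow> real set"
    assume "range A \<subseteq> sets (stieltjes h)" "disjoint_family A"
    then show "(\<Sum>i. emeasure N (A i)) = emeasure N (\<Union>i. A i)"
      using sets_sub by (intro suminf_emeasure) auto
  qed
  moreover have "positive (sets (stieltjes h)) (emeasure N)"
    by (simp add: positive_def)
  ultimately show ?thesis
    using ab sub N_eq
    by (intro emeasure_extend_measure_Pair[OF stieltjes_def, where \<mu>' = "emeasure N"]) auto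
qed

end

theory Submission
  imports Defs "HOL-Probability.Distribution_Functions"
begin

text \<open>
  Since \<open>p1 = q1\<close>, Tonelli's theorem turns the Copson norm of \<open>f\<close> into the \<open>L\<^sup>p\<close> norm of
  \<open>y = f v1 U\<close>, where \<open>U x\<close> is the norm of \<open>u1\<close> on \<open>(0,x)\<close>. With \<open>w = v / U\<close> the embedding becomes the
  Hardy inequality \<open>\<parallel>y\<parallel> in Ces(u2, w) \<le> c \<parallel>y\<parallel>\<^sub>p\<close>. Cut the half-line into the slices on which
  \<open>n t\<close>, the integral of \<open>u2\<close> to the power \<open>q\<close> over \<open>(t,\<infinity>)\<close>, is comparable to \<open>2 powr - k\<close>.
  A discrete Hardy inequality and Hoelder's inequality on each slice give the upper bounds; in the lower
  bounds one tests with near-extremals of Hoelder's inequality, on one interval \<open>(0,t)\<close> if \<open>p1 \<le> q2\<close>, and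
  on a suitable superposition over finitely many levels if \<open>q2 < p1\<close>. The Stieltjes measure of a slice is comparable
  to \<open>2 powr (- k r / q)\<close>, which converts sums over levels into the Stieltjes integral.
\<close>

section \<open>Real powers on the extended half-line\<close>

text \<open>Since \<open>u2\<close> is arbitrary, dyadic blocks of \<open>t\<close> say nothing
  about its mass, whereas level sets of \<open>n\<close> do. But \<open>n\<close> may stay bounded
  near 0; then small levels are empty and the leftmost nonempty slice can have arbitrarily little
  mass. Lower bounds therefore charge \<open>initial k\<close> to \<open>slice (k + 1)\<close>,
  whose mass is controlled as soon as \<open>initial k\<close> is nonempty. The measure with density
  \<open>u2 powr q\<close> and the Stieltjes measure assign to \<open>(a,b]\<close> the decrements
  of \<open>n powr 1\<close> and of \<open>n powr (r / q)\<close>, so one study of slices with a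
  general exponent \<rho> serves both. Infinite norms pass through most estimates, as everything
  lives in [0,\<infinity>]. The exception is the lower bound for \<open>q2 < p1\<close>, where a
  power of the unknown sum over levels must be cancelled: hence finitely many levels there, and a
  preliminary proof that every level contributes a finite amount. The exponent \<open>r\<close>,
  with 1/r = 1/q - 1/p, is the one that Hoelder's inequality over the levels produces.\<close>

lemma epowr_ennreal: "0 \<le> x \<Longrightarrow> ennreal x epowr a = ennreal (x powr a)"
  by (simp add: enn_powr_def)

lemma epowr_top [simp]: "\<infinity> epowr a = \<infinity>" "top epowr a = top"
  by (simp_all add: enn_powr_def)

lemma epowr_0 [simp]: "0 epowr a = 0"
  by (simp add: enn_powr_def)

lemma epowr_1 [simp]: "1 epowr a = 1"
  by (simp add: enn_powr_def)

lemma epowr_one [simp]: "x epowr 1 = x"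
  by (cases x) (auto simp: epowr_ennreal)

lemma epowr_mono: "x \<le> y \<Longrightarrow> 0 \<le> a \<Longrightarrow> x epowr a \<le> y epowr a"
  by (cases x; cases y) (auto simp: epowr_ennreal powr_mono2 top_unique)

lemma epowr_mult: "0 < a \<Longrightarrow> (x * y) epowr a = x epowr a * y epowr a"
proof (cases "x = 0 \<or> y = 0")
  case False
  assume "0 < a"
  then show ?thesis using False
    by (cases x; cases y)
      (auto simp: epowr_ennreal powr_mult ennreal_mult_top ennreal_top_mult simp flip: ennreal_mult)
qed auto

lemma epowr_epowr: "(x epowr a) epowr b = x epowr (a * b)"
  by (cases x) (auto simp: epowr_ennreal powr_powr)

lemma epowr_add: "0 < a \<Longrightarrow> 0 < b \<Longrightarrow> x epowr (a + b) = x epowr a * x epowr b"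
  by (cases x) (auto simp: epowr_ennreal powr_add ennreal_mult)

lemma epowr_eq_0_iff [simp]: "x epowr a = 0 \<longleftrightarrow> x = 0"
  by (cases x) (auto simp: epowr_ennreal ennreal_eq_0_iff)

lemma epowr_eq_top_iff [simp]: "x epowr a = top \<longleftrightarrow> x = top"
  by (cases x) (auto simp: epowr_ennreal)

lemma epowr_less_top_iff [simp]: "x epowr a < top \<longleftrightarrow> x < top"
  by (simp add: less_top[symmetric])

lemma epowr_le_iff:
  assumes "0 < a" shows "x epowr a \<le> y epowr a \<longleftrightarrow> x \<le> y"
proof
  assume "x epowr a \<le> y epowr a"
  then have "(x epowr a) epowr (1 / a) \<le> (y epowr a) epowr (1 / a)"
    using assms by (auto intro: epowr_mono[of _ _ "1 / a"])
  then show "x \<le> y" using assms by (simp add: epowr_epowr)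
qed (use assms in \<open>auto intro: epowr_mono\<close>)

lemma epowr_inverse_le_iff: "0 < a \<Longrightarrow> x epowr (1 / a) \<le> y \<longleftrightarrow> x \<le> y epowr a"
  using epowr_le_iff[of a "x epowr (1 / a)" y] by (simp add: epowr_epowr)

lemma borel_measurable_epowr [measurable]:
  assumes [measurable]: "f \<in> borel_measurable M"
  shows "(\<lambda>x. f x epowr a) \<in> borel_measurable M"
  unfolding enn_powr_def by measurable

text \<open>Each term is at most the whole sum, so a factor with exponent
  \<open>\<alpha> - 1\<close> leaves the sum as a constant. With \<open>\<alpha> = q / p\<close>
  this replaces Hoelder's inequality over the levels when \<open>p \<le> q\<close>.\<close>

lemma nn_integral_epowr_le_count_space:
  assumes "1 \<le> \<alpha>"
  shows "(\<integral>\<^sup>+k. g k epowr \<alpha> \<partial>count_space UNIV) \<le> (\<integral>\<^sup>+k. g k \<partial>count_space UNIV) epowr \<alpha>"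
proof (cases "\<alpha> = 1")
  case False
  then have \<alpha>: "1 < \<alpha>" using assms by auto
  let ?S = "\<integral>\<^sup>+k. g k \<partial>count_space UNIV"
  have split: "x epowr \<alpha> = x epowr (\<alpha> - 1) * x" for x
    using epowr_add[of "\<alpha> - 1" 1 x] \<alpha> by simp
  have "g k epowr \<alpha> \<le> ?S epowr (\<alpha> - 1) * g k" for k
    unfolding split using \<alpha> by (intro mult_right_mono epowr_mono nn_integral_ge_point) auto
  then have "(\<integral>\<^sup>+k. g k epowr \<alpha> \<partial>count_space UNIV) \<le> (\<integral>\<^sup>+k. ?S epowr (\<alpha> - 1) * g k \<partial>count_space UNIV)"
    by (intro nn_integral_mono) auto
  also have "\<dots> = ?S epowr \<alpha>"
    by (simp add: nn_integral_cmult split[of ?S])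
  finally show ?thesis .
qed simp

lemma epowr_Young:
  assumes "0 < \<theta>" "\<theta> < 1"
  shows "x epowr \<theta> * y epowr (1 - \<theta>) \<le> ennreal \<theta> * x + ennreal (1 - \<theta>) * y"
proof (cases "x = top \<or> y = top")
  case True
  then show ?thesis using assms by (auto simp: ennreal_mult_top)
next
  case False
  then obtain a b where "x = ennreal a" "y = ennreal b" "0 \<le> a" "0 \<le> b"
    by (cases x; cases y) auto
  then show ?thesis
    using Youngs_inequality_0[of \<theta> "1 - \<theta>" a b] assms
    by (cases "a = 0"; cases "b = 0")
      (auto simp: epowr_ennreal simp flip: ennreal_mult ennreal_plus intro!: ennreal_leI)
qed

text \<open>After division by both integrals, Young's inequality integrates to \<theta> + (1 -
  \<theta>) = 1. The weights \<theta> and 1 - \<theta> stand in place of conjugate exponents; in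
  this form the inequality serves Lebesgue integrals as well as sums over levels.\<close>

lemma nn_integral_Holder:
  assumes [measurable]: "f \<in> borel_measurable M" "g \<in> borel_measurable M"
    and \<theta>: "0 < \<theta>" "\<theta> < 1"
  shows "(\<integral>\<^sup>+x. f x epowr \<theta> * g x epowr (1 - \<theta>) \<partial>M)
    \<le> (\<integral>\<^sup>+x. f x \<partial>M) epowr \<theta> * (\<integral>\<^sup>+x. g x \<partial>M) epowr (1 - \<theta>)"
proof -
  define F where "F = (\<integral>\<^sup>+x. f x \<partial>M)"
  define G where "G = (\<integral>\<^sup>+x. g x \<partial>M)"
  \<comment> \<open>Normalising needs both integrals positive and finite. A zero integral
    annihilates the integrand, and an infinite one next to a nonzero one makes the bound
    infinite.\<close>
  consider "F = 0 \<or> G = 0" | "F \<noteq> 0" "G \<noteq> 0" "F = top \<or> G = top"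
    | "F \<noteq> 0" "G \<noteq> 0" "F \<noteq> top" "G \<noteq> top" by auto
  then show ?thesis
  proof cases
    case 1
    then have "AE x in M. f x = 0 \<or> g x = 0"
      unfolding F_def G_def by (auto simp: nn_integral_0_iff_AE)
    then have "(\<integral>\<^sup>+x. f x epowr \<theta> * g x epowr (1 - \<theta>) \<partial>M) = 0"
      by (subst nn_integral_0_iff_AE) (auto elim: eventually_mono)
    then show ?thesis by simp
  next
    case 2
    then show ?thesis
      unfolding F_def[symmetric] G_def[symmetric] by (auto simp: ennreal_mult_top ennreal_top_mult)
  next
    case 3
    have inv: "F * inverse F = 1" "G * inverse G = 1"
      using 3 by (auto simp: ennreal_divide_self divide_ennreal_def[symmetric] top.not_eq_extremum)
    let ?h = "\<lambda>x. (f x * inverse F) epowr \<theta> * (g x * inverse G) epowr (1 - \<theta>)"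
    have "F epowr \<theta> * G epowr (1 - \<theta>) * ?h x
        = (f x * (F * inverse F)) epowr \<theta> * (g x * (G * inverse G)) epowr (1 - \<theta>)" for x
      using \<theta> by (simp add: epowr_mult ac_simps)
    then have "(\<integral>\<^sup>+x. f x epowr \<theta> * g x epowr (1 - \<theta>) \<partial>M)
        = F epowr \<theta> * G epowr (1 - \<theta>) * (\<integral>\<^sup>+x. ?h x \<partial>M)"
      by (simp add: inv nn_integral_cmult[symmetric])
    also have "(\<integral>\<^sup>+x. ?h x \<partial>M)
        \<le> (\<integral>\<^sup>+x. ennreal \<theta> * (f x * inverse F) + ennreal (1 - \<theta>) * (g x * inverse G) \<partial>M)"
      by (intro nn_integral_mono epowr_Young \<theta>)
    also have "\<dots> = ennreal \<theta> * (F * inverse F) + ennreal (1 - \<theta>) * (G * inverse G)"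
      by (simp add: nn_integral_add nn_integral_cmult nn_integral_multc F_def G_def)
    also have "\<dots> = 1"
      using \<theta> by (simp add: inv flip: ennreal_plus)
    finally show ?thesis by (simp add: F_def G_def mult_left_mono)
  qed
qed

section \<open>Hoelder's inequality and its sharpness\<close>

lemma nn_integral_count_space_UN:
  assumes "countable I" "disjoint_family_on X I" "\<And>i. i \<in> I \<Longrightarrow> X i \<in> sets M"
    and [measurable]: "f \<in> borel_measurable M"
  shows "(\<integral>\<^sup>+x\<in>(\<Union>(X ` I)). f x \<partial>M) = (\<integral>\<^sup>+i. (\<integral>\<^sup>+x\<in>X i. f x \<partial>M) \<partial>count_space I)"
proof -
  \<comment> \<open>Integrals over sets are values of the measure with density \<open>f\<close>, so
    the claim becomes its countable additivity.\<close>
  have "(\<integral>\<^sup>+x\<in>A. f x \<partial>M) = emeasure (density M f) A" if "A \<in> sets M" for A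
    using that by (simp add: emeasure_density)
  then show ?thesis
    using emeasure_UN_countable[of I X "density M f"] assms
    by (simp add: sets.countable_UN'' cong: nn_integral_cong_simp)
qed

text \<open>An enumeration of the integers turns the integral into a series whose partial sums run
  over finite sets of levels; only such finite sums are controlled by the test functions for
  \<open>q < p\<close>.\<close>

lemma nn_integral_int_le:
  fixes f :: "int \<Rightarrow> ennreal"
  assumes "\<And>J. finite J \<Longrightarrow> sum f J \<le> B"
  shows "(\<integral>\<^sup>+k. f k \<partial>count_space UNIV) \<le> B"
proof -
  let ?g = "from_nat_into (UNIV :: int set)"
  have bij: "bij_betw ?g UNIV UNIV"
    by (intro bij_betw_from_nat_into) (auto simp: infinite_UNIV_int)
  have "(\<integral>\<^sup>+k. f k \<partial>count_space UNIV) = (\<Sum>i. f (?g i))"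
    by (simp add: nn_integral_bij_count_space[OF bij, symmetric] nn_integral_count_space_nat)
  also have "\<dots> \<le> B"
  proof (rule suminf_le_const)
    fix m
    have "inj_on ?g {..<m}"
      using bij by (auto simp: bij_betw_def intro: inj_on_subset)
    then have "(\<Sum>i<m. f (?g i)) = sum f (?g ` {..<m})"
      by (simp add: sum.reindex)
    then show "(\<Sum>i<m. f (?g i)) \<le> B" using assms by simp
  qed simp
  finally show ?thesis .
qed

lemma nn_integral_geometric_atMost:
  assumes "0 < x" "x < 1"
  shows "(\<integral>\<^sup>+j. ennreal (x powr (k - j)) \<partial>count_space {..k::int}) = ennreal (1 / (1 - x))"
proof -
  have "bij_betw (\<lambda>n. k - int n) UNIV {..k}"
    by (rule bij_betwI[where g="\<lambda>j. nat (k - j)"]) auto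
  from nn_integral_bij_count_space[OF this, of "\<lambda>j. ennreal (x powr (k - j))"]
  show ?thesis using assms
    by (simp add: nn_integral_count_space_nat suminf_ennreal2 summable_geometric suminf_geometric
        powr_realpow)
qed

lemma nn_integral_geometric_atLeast:
  assumes "0 < x" "x < 1"
  shows "(\<integral>\<^sup>+k. ennreal (x powr (k - j)) \<partial>count_space {j::int..}) = ennreal (1 / (1 - x))"
proof -
  have "bij_betw (\<lambda>n. j + int n) UNIV {j..}"
    by (rule bij_betwI[where g="\<lambda>k. nat (k - j)"]) auto
  from nn_integral_bij_count_space[OF this, of "\<lambda>k. ennreal (x powr (k - j))"]
  show ?thesis using assms
    by (simp add: nn_integral_count_space_nat suminf_ennreal2 summable_geometric suminf_geometric
        powr_realpow)
qed

text \<open>Each \<open>B j\<close> is at most \<open>\<theta> powr (k - j) * T k epowr (1 / Q)\<close>, so that only a geometric series is summed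
  inside the power; this covers \<open>Q < 1\<close> and \<open>Q \<ge> 1\<close> at once.\<close>

lemma discrete_Hardy:
  assumes Q: "0 < (Q::real)"
  obtains K :: real where "0 < K"
    "\<And>B :: int \<Rightarrow> ennreal.
      (\<integral>\<^sup>+k. ennreal (2 powr - real_of_int k) * (\<integral>\<^sup>+j. B j \<partial>count_space {..k}) epowr Q \<partial>count_space UNIV)
        \<le> ennreal K * (\<integral>\<^sup>+k. ennreal (2 powr - real_of_int k) * B k epowr Q \<partial>count_space UNIV)"
proof -
  \<comment> \<open>\<open>\<theta> powr Q = 2 powr - (1/2)\<close>: half of the decay of the weight
    \<open>2 powr - k\<close> is spent on summing \<open>B\<close> inside the power, the other half
    is kept for the sum over \<open>k\<close>.\<close>
  define \<theta> where "\<theta> = (2::real) powr - (1 / (2 * Q))"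
  have \<theta>: "0 < \<theta>" "\<theta> < 1"
    using Q powr_less_mono[of "- (1 / (2 * Q))" 0 2] by (auto simp: \<theta>_def)
  have s2: "0 < (2::real) powr - (1/2)" "(2::real) powr - (1/2) < 1"
    using powr_less_mono[of "- (1/2)" 0 2] by auto
  define L where "L = 1 / (1 - \<theta>)"
  define L' where "L' = 1 / (1 - 2 powr - (1/2::real))"
  have L: "0 < L" "0 < L'"
    using \<theta> s2 by (auto simp: L_def L'_def)
  show thesis
  proof (rule that[of "L powr Q * L'"])
    show "0 < L powr Q * L'" using L by simp
  next
    fix B :: "int \<Rightarrow> ennreal"
    define T where "T k = (\<integral>\<^sup>+j. ennreal (2 powr ((real_of_int k - j) / 2)) * B j epowr Q \<partial>count_space {..k})" for k :: int
    have Bj: "B j \<le> ennreal (\<theta> powr (k - j)) * T k epowr (1 / Q)" if "j \<le> k" for j k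
    proof -
      have c: "ennreal (2 powr - ((real_of_int k - j) / 2)) * ennreal (2 powr ((real_of_int k - j) / 2)) = 1"
        by (simp flip: ennreal_mult powr_add)
      have "ennreal (2 powr ((real_of_int k - j) / 2)) * B j epowr Q \<le> T k"
        unfolding T_def using that
        by (intro nn_integral_ge_point[where p="\<lambda>j. ennreal (2 powr ((real_of_int k - j) / 2)) * B j epowr Q"]) auto
      then have "ennreal (2 powr - ((real_of_int k - j) / 2)) * (ennreal (2 powr ((real_of_int k - j) / 2)) * B j epowr Q)
          \<le> ennreal (2 powr - ((real_of_int k - j) / 2)) * T k"
        by (intro mult_left_mono) auto
      also have "\<dots> = (ennreal (\<theta> powr (k - j)) * T k epowr (1 / Q)) epowr Q"
      proof -
        have "(\<theta> powr (k - j)) powr Q = 2 powr (- (1 / (2 * Q)) * (k - j) * Q)"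
          by (simp only: \<theta>_def powr_powr)
        also have "- (1 / (2 * Q)) * (k - j) * Q = - ((real_of_int k - j) / 2)"
          using Q by (simp add: divide_simps)
        finally show ?thesis
          using Q by (simp add: epowr_mult epowr_epowr epowr_ennreal)
      qed
      finally show ?thesis using Q
        by (simp add: mult.assoc[symmetric] c epowr_le_iff)
    qed
    have "(\<integral>\<^sup>+j. B j \<partial>count_space {..k}) \<le> ennreal L * T k epowr (1 / Q)" for k
    proof -
      have "(\<integral>\<^sup>+j. B j \<partial>count_space {..k}) \<le> (\<integral>\<^sup>+j. ennreal (\<theta> powr (k - j)) * T k epowr (1 / Q) \<partial>count_space {..k})"
        by (intro nn_integral_mono Bj) auto
      also have "\<dots> = ennreal L * T k epowr (1 / Q)"
        by (simp add: nn_integral_multc nn_integral_geometric_atMost[OF \<theta>] L_def del: of_int_diff)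
      finally show ?thesis .
    qed
    then have sum_le: "(\<integral>\<^sup>+j. B j \<partial>count_space {..k}) epowr Q \<le> ennreal (L powr Q) * T k" for k
      using epowr_mono[of "\<integral>\<^sup>+j. B j \<partial>count_space {..k}" "ennreal L * T k epowr (1 / Q)" Q] Q L
      by (simp add: epowr_mult epowr_epowr epowr_ennreal)
    \<comment> \<open>Interchanging the two sums leaves, for each \<open>j\<close>, a geometric
      series over \<open>k \<ge> j\<close> with ratio \<open>2 powr - (1/2)\<close> and sum
      \<open>L'\<close>.\<close>
    let ?w = "\<lambda>k::int. ennreal (2 powr - real_of_int k)"
    have "(\<integral>\<^sup>+k. ?w k * T k \<partial>count_space UNIV)
        = (\<integral>\<^sup>+k. \<integral>\<^sup>+j. ?w k * (ennreal (2 powr ((real_of_int k - j) / 2)) * B j epowr Q * indicator {..k} j)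
            \<partial>count_space UNIV \<partial>count_space UNIV)"
      by (simp add: T_def nn_integral_count_space_indicator nn_integral_cmult)
    also have "\<dots> = (\<integral>\<^sup>+j. \<integral>\<^sup>+k. ?w k * (ennreal (2 powr ((real_of_int k - j) / 2)) * B j epowr Q * indicator {..k} j)
            \<partial>count_space UNIV \<partial>count_space UNIV)"
      by (intro nn_integral_count_space_nn_integral) auto
    also have "\<dots> = (\<integral>\<^sup>+j. ?w j * B j epowr Q * ennreal L' \<partial>count_space UNIV)"
    proof (intro nn_integral_cong)
      fix j :: int
      have e: "?w k * (ennreal (2 powr ((real_of_int k - j) / 2)) * B j epowr Q * indicator {..k} j)
         = ?w j * B j epowr Q * (ennreal ((2 powr - (1/2)) powr (k - j)) * indicator {j..} k)" for k
      proof -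
        have "- real_of_int k + (real_of_int k - j) / 2 = - real_of_int j + (- (1/2)) * (k - j)"
          by (simp add: field_simps)
        then have "?w k * ennreal (2 powr ((real_of_int k - j) / 2)) = ?w j * ennreal ((2 powr - (1/2)) powr (k - j))"
          unfolding powr_powr by (simp only: ennreal_mult[symmetric] powr_ge_zero powr_add[symmetric])
        then show ?thesis by (simp add: indicator_def mult_ac)
      qed
      have "(\<integral>\<^sup>+k. ?w k * (ennreal (2 powr ((real_of_int k - j) / 2)) * B j epowr Q * indicator {..k} j) \<partial>count_space UNIV)
        = ?w j * B j epowr Q * (\<integral>\<^sup>+k. ennreal ((2 powr - (1/2)) powr (k - j)) * indicator {j..} k \<partial>count_space UNIV)"
        unfolding e by (rule nn_integral_cmult) auto
      then show "(\<integral>\<^sup>+k. ?w k * (ennreal (2 powr ((real_of_int k - j) / 2)) * B j epowr Q * indicator {..k} j) \<partial>count_space UNIV)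
        = ?w j * B j epowr Q * ennreal L'"
        unfolding L'_def nn_integral_geometric_atLeast[OF s2, of j, symmetric]
        by (simp add: nn_integral_count_space_indicator)
    qed
    also have "\<dots> = ennreal L' * (\<integral>\<^sup>+j. ?w j * B j epowr Q \<partial>count_space UNIV)"
      by (subst nn_integral_multc) (auto simp: mult.commute)
    finally have T: "(\<integral>\<^sup>+k. ?w k * T k \<partial>count_space UNIV) = \<dots>" .
    have "(\<integral>\<^sup>+k. ?w k * (\<integral>\<^sup>+j. B j \<partial>count_space {..k}) epowr Q \<partial>count_space UNIV)
        \<le> (\<integral>\<^sup>+k. ennreal (L powr Q) * (?w k * T k) \<partial>count_space UNIV)"
      by (intro nn_integral_mono) (simp add: sum_le mult_left_mono mult.left_commute[of "ennreal (L powr Q)"])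
    also have "\<dots> = ennreal (L powr Q * L') * (\<integral>\<^sup>+j. ?w j * B j epowr Q \<partial>count_space UNIV)"
      using L by (simp add: nn_integral_cmult T ennreal_mult mult.assoc)
    finally show "(\<integral>\<^sup>+k. ?w k * (\<integral>\<^sup>+j. B j \<partial>count_space {..k}) epowr Q \<partial>count_space UNIV)
        \<le> ennreal (L powr Q * L') * (\<integral>\<^sup>+j. ?w j * B j epowr Q \<partial>count_space UNIV)" .
  qed
qed

section \<open>Hoelder's inequality with the exponent \<open>p \<leadsto> a\<close>, and its
  near-extremals\<close>

lemma arrow_less:
  assumes "0 < a" "a < p"
  shows "ennreal p \<leadsto> ennreal a = ennreal (1 / (1 / a - 1 / p))"
proof -
  have "0 < 1 / a - 1 / p" "0 < p"
    using assms by (auto simp: field_simps)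
  then show ?thesis
    using assms by (simp add: arrow_def inverse_ennreal ennreal_minus ennreal_less_iff inverse_eq_divide)
qed

lemma arrow_self: "p \<leadsto> p = \<infinity>"
  by (simp add: arrow_def)

lemma Lnorm_ennreal:
  "0 < p \<Longrightarrow> Lnorm (ennreal p) A f = (\<integral>\<^sup>+x. f x epowr p \<partial>lebesgue_on A) epowr (1 / p)"
  by (simp add: Lnorm_def)

text \<open>Hoelder's inequality with weights \<open>1 - a / p\<close> and \<open>a / p\<close>; the
  exponent \<open>s\<close> of \<open>w\<close> is determined by \<open>s * (1 - a / p) = a\<close>.
  For \<open>a = p\<close> it degenerates to pulling out the essential supremum.\<close>

lemma nn_integral_Lnorm_Holder:
  assumes a: "0 < a" "a \<le> p"
    and [measurable]: "y \<in> borel_measurable (lebesgue_on A)" "w \<in> borel_measurable (lebesgue_on A)"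
  shows "(\<integral>\<^sup>+x. (y x * w x) epowr a \<partial>lebesgue_on A)
    \<le> Lnorm (ennreal p \<leadsto> ennreal a) A w epowr a * (\<integral>\<^sup>+x. y x epowr p \<partial>lebesgue_on A) epowr (a / p)"
proof (cases "a = p")
  case True
  define W where "W = esssup (lebesgue_on A) w"
  have "AE x in lebesgue_on A. (y x * w x) epowr a \<le> W epowr a * y x epowr a"
    using esssup_AE[where f=w and M="lebesgue_on A"]
  proof eventually_elim
    case (elim x)
    then have "(y x * w x) epowr a \<le> (W * y x) epowr a"
      using a by (intro epowr_mono) (auto simp: W_def mult.commute[of "y x"] mult_right_mono)
    then show ?case using a by (simp add: epowr_mult)
  qed
  then have "(\<integral>\<^sup>+x. (y x * w x) epowr a \<partial>lebesgue_on A) \<le> (\<integral>\<^sup>+x. W epowr a * y x epowr a \<partial>lebesgue_on A)"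
    by (rule nn_integral_mono_AE)
  also have "\<dots> = W epowr a * (\<integral>\<^sup>+x. y x epowr a \<partial>lebesgue_on A)"
    by (rule nn_integral_cmult) auto
  finally show ?thesis using True a by (simp add: arrow_self Lnorm_def W_def)
next
  case False
  define s where "s = 1 / (1 / a - 1 / p)"
  have s: "0 < s" "ennreal p \<leadsto> ennreal a = ennreal s"
    using a False arrow_less[of a p] by (auto simp: s_def field_simps)
  have as: "s * (1 - a / p) = a"
    using a False by (auto simp: s_def field_simps)
  have ap: "0 < 1 - a / p" "1 - a / p < 1" using a False by auto
  have "(y x * w x) epowr a = (w x epowr s) epowr (1 - a / p) * (y x epowr p) epowr (1 - (1 - a / p))" for x
  proof -
    have "(w x epowr s) epowr (1 - a / p) = w x epowr a" "p * (1 - (1 - a / p)) = a"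
      using a by (simp_all add: as epowr_epowr)
    then show ?thesis
      using a by (simp add: epowr_epowr epowr_mult mult.commute)
  qed
  then have "(\<integral>\<^sup>+x. (y x * w x) epowr a \<partial>lebesgue_on A)
      \<le> (\<integral>\<^sup>+x. w x epowr s \<partial>lebesgue_on A) epowr (1 - a / p)
        * (\<integral>\<^sup>+x. y x epowr p \<partial>lebesgue_on A) epowr (1 - (1 - a / p))"
    using nn_integral_Holder[OF _ _ ap, of "\<lambda>x. w x epowr s" "lebesgue_on A" "\<lambda>x. y x epowr p"] by simp
  moreover have "Lnorm (ennreal s) A w epowr a = (\<integral>\<^sup>+x. w x epowr s \<partial>lebesgue_on A) epowr (1 - a / p)"
  proof -
    have "1 / s * a = 1 - a / p"
      using s as by (simp add: field_simps)
    then show ?thesis using s(1) by (simp only: Lnorm_ennreal epowr_epowr)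
  qed
  ultimately show ?thesis using s by simp
qed

text \<open>Truncating values at \<open>n\<close> and the domain to sets of finite measure yields
  suitable minorants by monotone convergence. They are needed because extremals of Hoelder's
  inequality have to be normalised, while the natural candidates may have infinite integral.\<close>

lemma ex_finite_integral_less:
  assumes "sigma_finite_measure M" and [measurable]: "f \<in> borel_measurable M"
    and "b < (\<integral>\<^sup>+x. f x \<partial>M)"
  shows "\<exists>g\<in>borel_measurable M. (\<forall>x. g x \<le> f x) \<and> b < (\<integral>\<^sup>+x. g x \<partial>M) \<and> (\<integral>\<^sup>+x. g x \<partial>M) < \<infinity>"
proof -
  interpret sigma_finite_measure M by fact
  obtain C :: "nat \<Rightarrow> 'a set" where C: "range C \<subseteq> sets M" "(\<Union>i. C i) = space M"
    "\<And>i. emeasure M (C i) \<noteq> \<infinity>" "incseq C"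
    using sigma_finite_incseq by blast
  have [measurable]: "C i \<in> sets M" for i using C(1) by auto
  define g where "g n x = min (f x) (of_nat n) * indicator (C n) x" for n x
  have [measurable]: "g n \<in> borel_measurable M" for n unfolding g_def by measurable
  have "f x \<le> (SUP n. g n x)" if "x \<in> space M" for x
    unfolding le_SUP_iff
  proof safe
    fix z assume z: "z < f x"
    then obtain n where n: "z < of_nat n"
      using ennreal_Ex_less_of_nat[of z] less_le_trans[OF z top_greatest] by (auto simp: top.not_eq_extremum)
    have "x \<in> (\<Union>i. C i)" using that by (simp only: C(2))
    then obtain m where m: "x \<in> C m" by (rule UN_E)
    have "x \<in> C (max n m)" using m incseqD[OF C(4), of m "max n m"] by auto
    moreover have "z < of_nat (max n m)"
      using n by (rule order.strict_trans2) simp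
    ultimately show "\<exists>i\<in>UNIV. z < g i x"
      using z by (intro bexI[of _ "max n m"]) (auto simp: g_def)
  qed
  then have "(\<integral>\<^sup>+x. f x \<partial>M) \<le> (\<integral>\<^sup>+x. (SUP n. g n x) \<partial>M)"
    by (rule nn_integral_mono)
  also have "\<dots> = (SUP n. \<integral>\<^sup>+x. g n x \<partial>M)"
  proof (rule nn_integral_monotone_convergence_SUP)
    show "incseq g"
      using C(4) unfolding g_def incseq_def le_fun_def
      by (intro allI impI mult_mono min.mono) (auto simp: indicator_def)
  qed simp
  finally have "b < (SUP n. \<integral>\<^sup>+x. g n x \<partial>M)" using assms(3) by simp
  then obtain n where n: "b < (\<integral>\<^sup>+x. g n x \<partial>M)" by (auto simp: less_SUP_iff)
  have "(\<integral>\<^sup>+x. g n x \<partial>M) \<le> (\<integral>\<^sup>+x. of_nat n * indicator (C n) x \<partial>M)"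
    by (intro nn_integral_mono) (auto simp: g_def indicator_def)
  also have "\<dots> < \<infinity>"
    using C(3)[of n] by (simp add: nn_integral_cmult less_top[symmetric] ennreal_mult_eq_top_iff)
  finally show ?thesis
    using n by (intro bexI[of _ "g n"]) (auto simp: g_def indicator_def)
qed

lemma sigma_finite_lebesgue: "sigma_finite_measure (lebesgue :: 'a::euclidean_space measure)"
proof -
  obtain C :: "'a set set" where "countable C" "C \<subseteq> sets lborel" "\<Union>C = space lborel"
    "\<forall>A\<in>C. emeasure lborel A \<noteq> \<infinity>"
    using lborel.sigma_finite_countable by blast
  then show ?thesis
    by (intro sigma_finite_measure.intro exI[of _ C]) auto
qed

lemma sigma_finite_lebesgue_on: "A \<in> sets lebesgue \<Longrightarrow> sigma_finite_measure (lebesgue_on A)"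
  by (intro sigma_finite_measure_restrict_space sigma_finite_lebesgue)

text \<open>For \<open>a < p\<close> the extremals have \<open>y powr p\<close> proportional to
  \<open>w powr s\<close>; for \<open>a = p\<close> a near-extremal lives where \<open>w\<close>
  exceeds \<open>b\<close>. The strict inequality for \<open>b\<close> leaves room to replace either
  candidate by a minorant \<open>g\<close> of finite integral \<sigma>, and \<open>y powr p\<close>
  is then \<open>g\<close> divided by \<sigma>.\<close>

lemma nn_integral_Lnorm_Holder_sharp:
  assumes a: "0 < a" "a \<le> p" and A: "A \<in> sets lebesgue"
    and [measurable]: "w \<in> borel_measurable (lebesgue_on A)"
    and b: "b < Lnorm (ennreal p \<leadsto> ennreal a) A w"
  shows "\<exists>y\<in>borel_measurable (lebesgue_on A). (\<integral>\<^sup>+x. y x epowr p \<partial>lebesgue_on A) \<le> 1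
    \<and> b epowr a \<le> (\<integral>\<^sup>+x. (y x * w x) epowr a \<partial>lebesgue_on A)"
proof -
  let ?M = "lebesgue_on A"
  note sf = sigma_finite_lebesgue_on[OF A]
  have p: "0 < p" using a by simp
  show ?thesis
  proof (cases "a = p")
    case True
    define C where "C = {x \<in> space ?M. b < w x}"
    have [measurable]: "C \<in> sets ?M" unfolding C_def by measurable
    have "emeasure ?M C \<noteq> 0"
    proof
      assume "emeasure ?M C = 0"
      then have "AE x in ?M. w x \<le> b"
        using AE_iff_measurable[of C ?M "\<lambda>x. w x \<le> b"] \<open>C \<in> sets ?M\<close>
        by (simp add: C_def not_le)
      then have "esssup ?M w \<le> b" by (intro esssup_I) auto
      then show False using b True by (simp add: arrow_self Lnorm_def)
    qed
    then have "0 < (\<integral>\<^sup>+x. indicator C x \<partial>?M)" by (simp add: zero_less_iff_neq_zero)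
    then obtain g where g [measurable]: "g \<in> borel_measurable ?M" and gC: "\<And>x. g x \<le> indicator C x"
      and gi: "0 < (\<integral>\<^sup>+x. g x \<partial>?M)" "(\<integral>\<^sup>+x. g x \<partial>?M) < \<infinity>"
      using ex_finite_integral_less[OF sf, of "indicator C" 0] by auto
    obtain \<sigma> where \<sigma>: "0 < \<sigma>" "(\<integral>\<^sup>+x. g x \<partial>?M) = ennreal \<sigma>"
      using gi by (cases "\<integral>\<^sup>+x. g x \<partial>?M") auto
    define y where "y x = g x epowr (1 / p) * ennreal (\<sigma> powr - (1 / p))" for x
    have y_meas [measurable]: "y \<in> borel_measurable ?M" unfolding y_def by measurable
    have \<sigma>p: "(\<sigma> powr - (1 / p)) powr p = inverse \<sigma>"
      using p \<sigma> powr_minus[of \<sigma> 1] by (simp only: powr_powr) simp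
    have yp: "y x epowr p = g x * ennreal (inverse \<sigma>)" for x
      using p \<sigma> by (simp add: y_def epowr_mult epowr_epowr epowr_ennreal \<sigma>p)
    have inv: "ennreal \<sigma> * ennreal (inverse \<sigma>) = 1"
      using \<sigma> by (simp flip: ennreal_mult)
    have int1: "(\<integral>\<^sup>+x. y x epowr p \<partial>?M) = 1"
      by (simp add: yp nn_integral_multc \<sigma> inv)
    have "b epowr a = (\<integral>\<^sup>+x. b epowr a * y x epowr a \<partial>?M)"
      using int1 True by (subst nn_integral_cmult) auto
    also have "\<dots> \<le> (\<integral>\<^sup>+x. (y x * w x) epowr a \<partial>?M)"
    proof (rule nn_integral_mono)
      fix x assume x: "x \<in> space ?M"
      show "b epowr a * y x epowr a \<le> (y x * w x) epowr a"
      proof (cases "x \<in> C")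
        case True
        then show ?thesis using a
          by (auto simp: C_def epowr_mult mult.commute intro!: mult_right_mono epowr_mono)
      next
        case False
        then show ?thesis using gC[of x] by (simp add: y_def)
      qed
    qed
    finally show ?thesis using int1 by (intro bexI[of _ y] y_meas) auto
  next
    case False
    define s where "s = 1 / (1 / a - 1 / p)"
    have s: "0 < s" "ennreal p \<leadsto> ennreal a = ennreal s"
      using a False arrow_less[of a p] by (auto simp: s_def field_simps)
    have as: "a / p + a / s = 1" "a / s = 1 - a / p"
      using a False by (auto simp: s_def field_simps)
    have bs: "b epowr s < (\<integral>\<^sup>+x. w x epowr s \<partial>?M)"
      using b s by (simp add: Lnorm_ennreal not_le[symmetric] epowr_inverse_le_iff)
    from ex_finite_integral_less[OF sf _ this]
    obtain g where g [measurable]: "g \<in> borel_measurable ?M" and gw: "\<And>x. g x \<le> w x epowr s"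
      and gi: "b epowr s < (\<integral>\<^sup>+x. g x \<partial>?M)" "(\<integral>\<^sup>+x. g x \<partial>?M) < \<infinity>" by auto
    obtain \<sigma> where \<sigma>: "0 < \<sigma>" "(\<integral>\<^sup>+x. g x \<partial>?M) = ennreal \<sigma>"
      using le_less_trans[OF zero_le gi(1)] gi(2) by (cases "\<integral>\<^sup>+x. g x \<partial>?M") auto
    define y where "y x = g x epowr (1 / p) * ennreal (\<sigma> powr - (1 / p))" for x
    have y_meas [measurable]: "y \<in> borel_measurable ?M" unfolding y_def by measurable
    have \<sigma>p: "(\<sigma> powr - (1 / p)) powr p = inverse \<sigma>"
      using p \<sigma> powr_minus[of \<sigma> 1] by (simp only: powr_powr) simp
    have yp: "y x epowr p = g x * ennreal (inverse \<sigma>)" for x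
      using p \<sigma> by (simp add: y_def epowr_mult epowr_epowr epowr_ennreal \<sigma>p)
    have inv: "ennreal \<sigma> * ennreal (inverse \<sigma>) = 1"
      using \<sigma> by (simp flip: ennreal_mult)
    have int1: "(\<integral>\<^sup>+x. y x epowr p \<partial>?M) = 1"
      by (simp add: yp nn_integral_multc \<sigma> inv)
    \<comment> \<open>\<open>g\<close> splits with the weights \<open>a / p\<close> and
      \<open>a / s\<close>, whose sum is 1: the first factor is \<open>y powr a\<close> up to
      normalisation, and only the second is enlarged to \<open>w powr a\<close>.\<close>
    have le: "ennreal (\<sigma> powr - (a / p)) * g x \<le> (y x * w x) epowr a" for x
    proof -
      have "g x = g x epowr (a / p) * g x epowr (a / s)"
        using epowr_add[of "a / p" "a / s" "g x"] a p s by (simp add: as(1))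
      also have "\<dots> \<le> g x epowr (a / p) * w x epowr a"
        using epowr_mono[OF gw[of x], of "a / s"] a s
        by (intro mult_left_mono) (auto simp: epowr_epowr)
      finally have "g x * ennreal (\<sigma> powr - (a / p)) \<le> g x epowr (a / p) * w x epowr a * ennreal (\<sigma> powr - (a / p))"
        by (rule mult_right_mono) simp
      also have "\<dots> = (y x * w x) epowr a"
        using a by (simp add: y_def epowr_mult epowr_epowr epowr_ennreal powr_powr mult_ac)
      finally show ?thesis by (simp add: mult.commute)
    qed
    have "b epowr a = (b epowr s) epowr (a / s)" using s by (simp add: epowr_epowr)
    also have "\<dots> \<le> ennreal \<sigma> epowr (a / s)"
      using gi(1) a s unfolding \<sigma>(2) by (intro epowr_mono) auto
    also have "\<dots> = ennreal (\<sigma> powr - (a / p)) * ennreal \<sigma>"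
      using \<sigma>(1) by (simp add: as(2) epowr_ennreal powr_diff powr_minus field_simps flip: ennreal_mult)
    also have "\<dots> = (\<integral>\<^sup>+x. ennreal (\<sigma> powr - (a / p)) * g x \<partial>?M)"
      by (simp add: nn_integral_cmult \<sigma>)
    also have "\<dots> \<le> (\<integral>\<^sup>+x. (y x * w x) epowr a \<partial>?M)"
      by (intro nn_integral_mono le)
    finally show ?thesis using int1 by (intro bexI[of _ y] y_meas) auto
  qed
qed

section \<open>Level sets of tail functions\<close>

text \<open>Abstracts the tail integral of \<open>u powr q\<close>. The limit at 0 may be finite or
  infinite, so small levels can be empty; continuity and the limit 0 at infinity ensure that every
  positive value below an attained one is attained further right.\<close>

locale tail_function =
  fixes n :: "real \<Rightarrow> real"
  assumes cont: "continuous_on {0<..} n"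
    and anti: "\<And>s t. 0 < s \<Longrightarrow> s \<le> t \<Longrightarrow> n t \<le> n s"
    and pos: "\<And>t. 0 < t \<Longrightarrow> 0 < n t"
    and lim: "(n \<longlongrightarrow> 0) at_top"
begin

lemma ex_level:
  assumes "0 < c" "0 < t" "c < n t"
  shows "\<exists>a>t. n a = c"
proof -
  have "eventually (\<lambda>x. n x < c) at_top"
    using lim assms(1) by (rule order_tendstoD)
  then obtain B where B: "\<And>x. B \<le> x \<Longrightarrow> n x < c"
    by (auto simp: eventually_at_top_linorder)
  define b where "b = max B t"
  have b: "n b < c" "t \<le> b"
    by (auto simp: b_def intro: B)
  have "continuous_on {t..b} n"
    by (rule continuous_on_subset[OF cont]) (use assms(2) in auto)
  then obtain x where x: "t \<le> x" "x \<le> b" "n x = c"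
    using IVT2'[of n b c t] assms(3) b by fastforce
  with assms(3) have "t < x" by (cases "t = x") auto
  with x show ?thesis by blast
qed

lemma tendsto_at: "0 < x \<Longrightarrow> (n \<longlongrightarrow> n x) (at x)"
  using cont by (simp add: continuous_on_eq_continuous_at isCont_def)


text \<open>The minus sign makes levels increase with \<open>t\<close>. The floor excludes the lower
  end of each dyadic range, so \<open>initial k\<close> is the open superlevel set of
  \<open>n\<close> above \<open>2 powr (- k - 1)\<close>.\<close>

definition level :: "real \<Rightarrow> int" where "level t = \<lfloor>- log 2 (n t)\<rfloor>"

definition slice :: "int \<Rightarrow> real set" where "slice k = {t. 0 < t \<and> level t = k}"

definition initial :: "int \<Rightarrow> real set" where "initial k = {t. 0 < t \<and> level t \<le> k}"

lemma level_eq_iff: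
  assumes "0 < t"
  shows "level t = k \<longleftrightarrow> 2 powr (- real_of_int k - 1) < n t \<and> n t \<le> 2 powr - real_of_int k"
proof -
  have "n t \<le> 2 powr - real_of_int k \<longleftrightarrow> log 2 (n t) \<le> - real_of_int k"
    using pos[OF assms] by (simp add: log_le_iff)
  moreover have "2 powr (- real_of_int k - 1) < n t \<longleftrightarrow> - real_of_int k - 1 < log 2 (n t)"
    using pos[OF assms] by (simp add: less_log_iff)
  ultimately show ?thesis
    unfolding level_def floor_eq_iff by linarith
qed

lemma slice_bounds:
  assumes "t \<in> slice k"
  shows "0 < t" "2 powr (- real_of_int k - 1) < n t" "n t \<le> 2 powr - real_of_int k"
  using assms level_eq_iff[of t k] by (simp_all add: slice_def)

lemma level_le_iff:
  assumes "0 < t"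
  shows "level t \<le> k \<longleftrightarrow> 2 powr (- real_of_int k - 1) < n t"
proof -
  have "2 powr (- real_of_int k - 1) < n t \<longleftrightarrow> - real_of_int k - 1 < log 2 (n t)"
    using pos[OF assms] by (simp add: less_log_iff)
  then show ?thesis
    unfolding level_def floor_le_iff by linarith
qed

lemma level_mono: "0 < s \<Longrightarrow> s \<le> t \<Longrightarrow> level s \<le> level t"
  using anti[of s t] pos[of s] pos[of t] by (auto simp: level_def intro!: floor_mono)

lemma initial_eq: "initial k = (\<Union>j\<in>{..k}. slice j)"
  by (auto simp: initial_def slice_def)

lemma disjoint_slice: "disjoint_family_on slice I"
  by (auto simp: disjoint_family_on_def slice_def)

lemma UN_slice: "(\<Union>k. slice k) = {0<..}"
  by (auto simp: slice_def)

lemma slice_subset: "slice k \<subseteq> {0<..}"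
  by (auto simp: slice_def)

lemma initial_subset: "initial k \<subseteq> {0<..}"
  by (auto simp: initial_def)

lemma initial_borel [measurable]: "initial k \<in> sets borel"
proof -
  have "initial k = {0<..} \<inter> n -` {2 powr (- real_of_int k - 1)<..}"
    by (auto simp: initial_def level_le_iff)
  moreover have "open ({0<..} \<inter> n -` {2 powr (- real_of_int k - 1)<..})"
    by (intro continuous_open_preimage cont) auto
  ultimately show ?thesis by simp
qed

lemma slice_borel [measurable]: "slice k \<in> sets borel"
proof -
  have "slice k = initial k - initial (k - 1)"
    by (auto simp: slice_def initial_def)
  then show ?thesis by simp
qed

lemma Ioo_subset_initial: "t \<in> slice k \<Longrightarrow> {0<..<t} \<subseteq> initial k"
  using level_mono by (auto simp: slice_def initial_def)

lemma initial_subset_Ioo: "t \<in> slice (k + 1) \<Longrightarrow> initial k \<subseteq> {0<..<t}"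
proof
  fix x assume "t \<in> slice (k + 1)" "x \<in> initial k"
  then show "x \<in> {0<..<t}"
    using level_mono[of t x] by (cases "x < t") (auto simp: slice_def initial_def)
qed

text \<open>At a point of \<open>initial k\<close> the threshold is exceeded, so it is attained
  further right, and monotonicity puts that point beyond the whole set. For an empty
  \<open>initial k\<close> the threshold need not be attained at all.\<close>

lemma initial_less_ex:
  assumes "initial k \<noteq> {}"
  obtains t where "0 < t" "n t = 2 powr (- real_of_int k - 1)" "initial k \<subseteq> {0<..<t}"
proof -
  obtain t where t: "0 < t" "2 powr (- real_of_int k - 1) < n t"
    using assms by (auto simp: initial_def level_le_iff)
  then obtain a where a: "t < a" "n a = 2 powr (- real_of_int k - 1)"
    using ex_level[of "2 powr (- real_of_int k - 1)" t] by auto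
  have "initial k \<subseteq> {0<..<a}"
  proof
    fix x assume "x \<in> initial k"
    then show "x \<in> {0<..<a}"
      using anti[of a x] a t by (cases "x < a") (auto simp: initial_def level_le_iff)
  qed
  then show thesis using that[of a] a t by simp
qed

text \<open>Two measures are treated at once: \<open>\<mu>\<close>, on Lebesgue sets, with
  \<open>\<rho> = 1\<close>, and the Stieltjes measure, on Borel sets, with
  \<open>\<rho> = r / q\<close>. This is the reason for the disjunction about
  \<open>sets M\<close>.\<close>

context
  fixes M :: "real measure" and \<rho> :: real
  assumes \<rho>: "0 < \<rho>"
    and sets_M: "sets M = sets (lebesgue_on {0<..}) \<or> sets M = sets (restrict_space borel {0<..})"
    and emeasure_Ioc: "\<And>a b. 0 < a \<Longrightarrow> a \<le> b \<Longrightarrow> emeasure M {a<..b} = ennreal (n a powr \<rho> - n b powr \<rho>)"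
begin

lemma borel_in_sets: "A \<in> sets borel \<Longrightarrow> A \<subseteq> {0<..} \<Longrightarrow> A \<in> sets M"
  using sets_M by (elim disjE) (simp_all add: sets_restrict_space_iff)

lemma space_M: "space M = {0<..}"
  using sets_M by (elim disjE) (drule sets_eq_imp_space_eq, simp add: space_restrict_space)+

lemma slice_in_sets: "slice k \<in> sets M"
  by (intro borel_in_sets slice_borel slice_subset)

text \<open>Masses are known only for half-open intervals away from 0, while a slice may reach down
  to 0. It is covered by increasing intervals \<open>X i\<close> whose left ends stay positive and
  decrease to \<open>m\<close>.\<close>

lemma emeasure_slice_le:
  "emeasure M (slice k) \<le> ennreal (2 powr \<rho> * 2 powr (- real_of_int k * \<rho>))"
proof (cases "slice k = {}")
  case False
  \<comment> \<open>Twice the upper bound of \<open>n\<close> on the slice: by continuity each point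
    of the slice then has a point of \<open>A\<close> strictly to its left, as half-open intervals
    require. The doubling is the origin of the factor \<open>2 powr \<rho>\<close>.\<close>
  let ?c = "2 powr (1 - real_of_int k)"
  define A where "A = {a. 0 < a \<and> n a \<le> ?c}"
  have c: "2 powr - real_of_int k < ?c" by simp
  have bdd: "bdd_below A" by (rule bdd_belowI[of _ 0]) (simp add: A_def)
  have sub: "\<exists>a\<in>A. a < t" if "t \<in> slice k" for t
  proof -
    have t: "0 < t" "n t < ?c"
      using slice_bounds[OF that] c by (auto intro: order.strict_trans1)
    have "eventually (\<lambda>x. n x < ?c) (at t)"
      using tendsto_at[OF t(1)] t(2) by (rule order_tendstoD)
    then have "eventually (\<lambda>x. n x < ?c) (at_left t)"
      by (simp add: eventually_at_split)
    moreover have "eventually (\<lambda>x. x \<in> {0<..<t}) (at_left t)"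
      using t(1) by (rule eventually_at_leftI[rotated]) auto
    ultimately have "eventually (\<lambda>x. n x < ?c \<and> x \<in> {0<..<t}) (at_left t)"
      by (rule eventually_conj)
    then obtain x where "n x < ?c" "x \<in> {0<..<t}"
      using eventually_happens[of _ "at_left t"] by auto
    then show ?thesis by (auto simp: A_def intro!: bexI[of _ x])
  qed
  with False have A: "A \<noteq> {}" by auto
  define m where "m = Inf A"
  have m0: "0 \<le> m" unfolding m_def using A by (intro cInf_greatest) (auto simp: A_def)
  define X where "X i = {m + 1 / real (Suc i) <.. m + 1 + real i}" for i
  have X_sets: "X i \<in> sets M" for i
  proof (rule borel_in_sets)
    have "0 < m + 1 / real (Suc i)" using m0 by (simp add: add_nonneg_pos)
    then show "X i \<subseteq> {0<..}" by (auto simp: X_def simp del: of_nat_Suc)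
  qed (simp add: X_def)
  have X_le: "emeasure M (X i) \<le> ennreal (2 powr \<rho> * 2 powr (- real_of_int k * \<rho>))" for i
  proof -
    let ?a = "m + 1 / real (Suc i)"
    have "m < ?a" by simp
    then obtain a where a: "a \<in> A" "a < ?a"
      using cInf_less_iff[OF A bdd, of ?a] unfolding m_def by blast
    then have "n ?a \<le> ?c"
      using anti[of a ?a] by (auto simp: A_def)
    moreover have a0: "0 < ?a" using m0 by (simp add: add_nonneg_pos)
    moreover have "1 / real (Suc i) \<le> 1 + real i" by (simp add: field_simps)
    moreover have "n ?a powr \<rho> - n (m + 1 + real i) powr \<rho> \<le> ?c powr \<rho>"
    proof -
      have "n ?a powr \<rho> \<le> ?c powr \<rho>"
        using \<rho> pos[OF a0] \<open>n ?a \<le> ?c\<close> by (intro powr_mono2) auto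
      moreover have "0 \<le> n (m + 1 + real i) powr \<rho>" by simp
      ultimately show ?thesis by linarith
    qed
    ultimately have "emeasure M (X i) \<le> ennreal (?c powr \<rho>)"
      unfolding X_def by (subst emeasure_Ioc) (auto intro!: ennreal_leI)
    also have "?c powr \<rho> = 2 powr \<rho> * 2 powr (- real_of_int k * \<rho>)"
      by (simp only: powr_powr powr_add[symmetric]) (simp add: algebra_simps)
    finally show ?thesis .
  qed
  have "slice k \<subseteq> (\<Union>i. X i)"
  proof
    fix t assume "t \<in> slice k"
    then obtain a where "a \<in> A" "a < t" using sub by blast
    then have "m < t" unfolding m_def using cInf_lower[OF _ bdd] by fastforce
    then obtain i where i: "1 / real (Suc i) < t - m"
      using nat_approx_posE[of "t - m"] by auto
    obtain j where j: "t - m < real j" using reals_Archimedean2 by blast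
    have "1 / real (Suc (max i j)) \<le> 1 / real (Suc i)" by (simp add: field_simps)
    then have "t \<in> X (max i j)" using i j unfolding X_def by auto
    then show "t \<in> (\<Union>i. X i)" by blast
  qed
  then have "emeasure M (slice k) \<le> emeasure M (\<Union>i. X i)"
    using X_sets by (intro emeasure_mono) auto
  also have "\<dots> = (SUP i. emeasure M (X i))"
  proof (rule SUP_emeasure_incseq[symmetric])
    show "range X \<subseteq> sets M"
      using X_sets by auto
    show "incseq X"
    proof (rule incseq_SucI)
      fix i
      have "1 / real (Suc (Suc i)) \<le> 1 / real (Suc i)" by (simp add: field_simps)
      then show "X i \<subseteq> X (Suc i)" by (auto simp: X_def)
    qed
  qed
  also have "\<dots> \<le> ennreal (2 powr \<rho> * 2 powr (- real_of_int k * \<rho>))"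
    by (intro SUP_least X_le)
  finally show ?thesis .
qed simp

text \<open>If \<open>initial k\<close> is nonempty, \<open>n\<close> attains the top value of
  \<open>slice (k + 1)\<close> and then decreases continuously through its dyadic range. Otherwise
  \<open>slice (k + 1)\<close> could be the leftmost slice, with almost no mass.\<close>

lemma emeasure_slice_ge:
  assumes "initial k \<noteq> {}"
  shows "ennreal (2 powr - \<rho> * (1 - (3/4) powr \<rho>) * 2 powr (- real_of_int k * \<rho>)) \<le> emeasure M (slice (k + 1))"
proof -
  let ?c = "2 powr (- real_of_int k - 1)"
  obtain a where a: "0 < a" "n a = ?c" using initial_less_ex[OF assms] .
  \<comment> \<open>Any factor strictly between 1/2 and 1 would serve: \<open>b\<close> stays inside
    the slice and the interval keeps a fixed share of the mass.\<close>
  obtain b where b: "a < b" "n b = 3/4 * ?c"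
    using ex_level[of "3/4 * ?c" a] a by auto
  have "{a<..b} \<subseteq> slice (k + 1)"
  proof
    fix x assume x: "x \<in> {a<..b}"
    then have "3/4 * ?c \<le> n x" "n x \<le> ?c" using anti[of a x] anti[of x b] a b by auto
    moreover have "- real_of_int (k + 1) = - real_of_int k - 1" by simp
    moreover have "2 powr (- real_of_int (k + 1) - 1) < 3/4 * ?c"
    proof -
      have "2 powr (- real_of_int (k + 1) - 1) = 1/2 * ?c"
        using powr_add[of 2 "- real_of_int k - 1" "-1"] by (simp add: powr_minus algebra_simps)
      moreover have "0 < ?c" by simp
      ultimately show ?thesis by linarith
    qed
    ultimately show "x \<in> slice (k + 1)"
      using x a level_eq_iff[of x "k + 1"] by (simp add: slice_def)
  qed
  then have "emeasure M {a<..b} \<le> emeasure M (slice (k + 1))"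
    by (intro emeasure_mono slice_in_sets)
  also have "emeasure M {a<..b} = ennreal ((1 - (3/4) powr \<rho>) * ?c powr \<rho>)"
  proof -
    have "n b powr \<rho> = (3/4) powr \<rho> * ?c powr \<rho>"
      unfolding b(2) by (rule powr_mult)
    then show ?thesis
      using a b(1) by (subst emeasure_Ioc) (simp_all add: left_diff_distrib)
  qed
  also have "?c powr \<rho> = 2 powr - \<rho> * 2 powr (- real_of_int k * \<rho>)"
  proof -
    have "(- real_of_int k - 1) * \<rho> = - \<rho> + - real_of_int k * \<rho>"
      by (simp add: algebra_simps)
    then show ?thesis by (simp only: powr_powr powr_add[symmetric])
  qed
  finally show ?thesis by (simp add: mult_ac)
qed

lemma nn_integral_slices:
  assumes "g \<in> borel_measurable M"
  shows "(\<integral>\<^sup>+t. g t \<partial>M) = (\<integral>\<^sup>+k. (\<integral>\<^sup>+t\<in>slice k. g t \<partial>M) \<partial>count_space UNIV)"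
proof -
  have "(\<integral>\<^sup>+t. g t \<partial>M) = (\<integral>\<^sup>+t\<in>(\<Union>(slice ` UNIV)). g t \<partial>M)"
    by (intro nn_integral_cong) (auto simp: space_M UN_slice)
  then show ?thesis
    using assms by (subst (asm) nn_integral_count_space_UN) (auto simp: disjoint_slice slice_in_sets)
qed

lemma nn_integral_le_slices:
  assumes "g \<in> borel_measurable M" "\<And>k t. t \<in> slice k \<Longrightarrow> g t \<le> c k"
  shows "(\<integral>\<^sup>+t. g t \<partial>M) \<le> (\<integral>\<^sup>+k. c k * ennreal (2 powr \<rho> * 2 powr (- real_of_int k * \<rho>)) \<partial>count_space UNIV)"
  unfolding nn_integral_slices[OF assms(1)]
proof (rule nn_integral_mono)
  fix k
  have "(\<integral>\<^sup>+t\<in>slice k. g t \<partial>M) \<le> (\<integral>\<^sup>+t. c k * indicator (slice k) t \<partial>M)"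
    using assms(2) by (intro nn_integral_mono) (auto simp: indicator_def)
  also have "\<dots> = c k * emeasure M (slice k)"
    by (simp add: nn_integral_cmult_indicator slice_in_sets)
  also have "\<dots> \<le> c k * ennreal (2 powr \<rho> * 2 powr (- real_of_int k * \<rho>))"
    by (intro mult_left_mono emeasure_slice_le) simp
  finally show "(\<integral>\<^sup>+t\<in>slice k. g t \<partial>M) \<le> c k * ennreal (2 powr \<rho> * 2 powr (- real_of_int k * \<rho>))" .
qed

text \<open>The shift by one slice makes room for all of \<open>initial k\<close> to the left of \<open>slice (k + 1)\<close>.\<close>

lemma slices_le_nn_integral:
  assumes "g \<in> borel_measurable M" "\<And>k t. t \<in> slice (k + 1) \<Longrightarrow> c k \<le> g t"
    and "\<And>k. initial k = {} \<Longrightarrow> c k = 0"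
  shows "ennreal (2 powr - \<rho> * (1 - (3/4) powr \<rho>)) * (\<integral>\<^sup>+k. c k * ennreal (2 powr (- real_of_int k * \<rho>)) \<partial>count_space UNIV)
    \<le> (\<integral>\<^sup>+t. g t \<partial>M)"
proof -
  have pos: "0 \<le> 2 powr - \<rho> * (1 - (3/4) powr \<rho>)"
    using \<rho> powr_mono2[of \<rho> "3/4" 1] by simp
  have bij: "bij_betw (\<lambda>k. k + 1) (UNIV :: int set) UNIV"
    by (rule bij_betwI[where g="\<lambda>k. k - 1"]) auto
  have "ennreal (2 powr - \<rho> * (1 - (3/4) powr \<rho>)) * (\<integral>\<^sup>+k. c k * ennreal (2 powr (- real_of_int k * \<rho>)) \<partial>count_space UNIV)
      = (\<integral>\<^sup>+k. c k * ennreal (2 powr - \<rho> * (1 - (3/4) powr \<rho>) * 2 powr (- real_of_int k * \<rho>)) \<partial>count_space UNIV)"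
    using pos by (subst nn_integral_cmult[symmetric]) (auto simp: ennreal_mult[OF pos] mult.left_commute)
  also have "\<dots> \<le> (\<integral>\<^sup>+k. (\<integral>\<^sup>+t\<in>slice (k + 1). g t \<partial>M) \<partial>count_space UNIV)"
  proof (rule nn_integral_mono)
    fix k
    show "c k * ennreal (2 powr - \<rho> * (1 - (3/4) powr \<rho>) * 2 powr (- real_of_int k * \<rho>))
       \<le> (\<integral>\<^sup>+t\<in>slice (k + 1). g t \<partial>M)"
    proof (cases "initial k = {}")
      case False
      have "c k * ennreal (2 powr - \<rho> * (1 - (3/4) powr \<rho>) * 2 powr (- real_of_int k * \<rho>))
          \<le> c k * emeasure M (slice (k + 1))"
        by (intro mult_left_mono emeasure_slice_ge False) simp
      also have "\<dots> = (\<integral>\<^sup>+t. c k * indicator (slice (k + 1)) t \<partial>M)"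
        by (simp add: nn_integral_cmult_indicator slice_in_sets)
      also have "\<dots> \<le> (\<integral>\<^sup>+t\<in>slice (k + 1). g t \<partial>M)"
        using assms(2) by (intro nn_integral_mono) (auto simp: indicator_def)
      finally show ?thesis .
    qed (simp add: assms(3))
  qed
  also have "\<dots> = (\<integral>\<^sup>+t. g t \<partial>M)"
    unfolding nn_integral_slices[OF assms(1)]
    using nn_integral_bij_count_space[OF bij, of "\<lambda>k. (\<integral>\<^sup>+t\<in>slice k. g t \<partial>M)"] by simp
  finally show ?thesis .
qed

end

end

section \<open>The Stieltjes measure of a power of a tail function\<close>

lemma sets_stieltjes: "sets (stieltjes h) = sets (restrict_space borel {0<..})"
proof -
  let ?G = "(\<lambda>(a, b). {a<..b}) ` {(a, b). 0 < a \<and> a \<le> (b::real)}"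
  have sub: "?G \<subseteq> Pow {0<..}" by auto
  have eq: "sets (stieltjes h) = sigma_sets {0<..} ?G"
    unfolding stieltjes_def by (rule sets_extend_measure[OF sub])
  have Ioc: "{a<..b} \<in> sigma_sets {0<..} ?G" if "0 < a" for a b :: real
  proof (cases "a \<le> b")
    case True
    with that show ?thesis by (intro sigma_sets.Basic) auto
  next
    case False
    then have "{a<..b} = {}" by auto
    then show ?thesis by (simp add: sigma_sets.Empty)
  qed
  have "X \<in> sets borel" "X \<subseteq> {0<..}" if "X \<in> sigma_sets {0<..} ?G" for X
    using that by induction auto
  moreover have "X \<inter> {0<..} \<in> sigma_sets {0<..} ?G" if "X \<in> sets borel" for X
  proof -
    have "X \<in> sigma_sets UNIV (range (\<lambda>(a, b). {a<..b::real}))"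
      using that by (simp add: borel_sigma_sets_Ioc)
    then show ?thesis
    proof induction
      case (Basic X)
      then obtain a b where X: "X = {a<..b}" by auto
      show ?case
      proof (cases "0 < a")
        case True
        then have "X \<inter> {0<..} = {a<..b}" using X by auto
        then show ?thesis using Ioc[OF True] by simp
      next
        case False
        \<comment> \<open>Only intervals with positive left end are generators; here the positive
          part of \<open>X\<close> is exhausted by such intervals.\<close>
        have "X \<inter> {0<..} = (\<Union>i. {1 / real (Suc i)<..b})"
        proof (intro set_eqI iffI)
          fix x assume x: "x \<in> X \<inter> {0<..}"
          then obtain i where "1 / real (Suc i) < x" using nat_approx_posE[of x] by auto
          with x X show "x \<in> (\<Union>i. {1 / real (Suc i)<..b})" by auto
        next
          fix x assume "x \<in> (\<Union>i. {1 / real (Suc i)<..b})"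
          then obtain i where "1 / real (Suc i) < x" "x \<le> b" by auto
          moreover have "0 < 1 / real (Suc i)" by simp
          ultimately have "0 < x" "a < x" using False by linarith+
          then show "x \<in> X \<inter> {0<..}" using X \<open>x \<le> b\<close> by simp
        qed
        then show ?thesis by (auto intro!: sigma_sets.Union Ioc)
      qed
    next
      case Empty
      then show ?case by (simp add: sigma_sets.Empty)
    next
      case (Compl X)
      have "(UNIV - X) \<inter> {0<..} = {0<..} - X \<inter> {0<..}" by auto
      then show ?case using Compl by (simp add: sigma_sets.Compl)
    next
      case (Union X)
      have "(\<Union>i. X i) \<inter> {0<..} = (\<Union>i. X i \<inter> {0<..})" by auto
      then show ?case using Union by (simp only:) (rule sigma_sets.Union)
    qed
  qed
  then have "X \<in> sigma_sets {0<..} ?G" if "X \<in> sets borel" "X \<subseteq> {0<..}" for X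
    using that by (metis inf_absorb1)
  ultimately have "sigma_sets {0<..} ?G = {X \<in> sets borel. X \<subseteq> {0<..}}"
    by blast
  then show ?thesis
    unfolding eq by (auto simp: sets_restrict_space_iff)
qed

text \<open>Continuity of \<open>n\<close> identifies the right limits in the definition of the
  measure with values of \<open>h\<close>.\<close>

lemma (in tail_function) emeasure_stieltjes_tail:
  assumes "0 < \<rho>" "0 < a" "a \<le> b" "\<And>t. 0 < t \<Longrightarrow> h t = - (n t powr \<rho>)"
  shows "emeasure (stieltjes h) {a<..b} = ennreal (n a powr \<rho> - n b powr \<rho>)"
proof -
  have mono: "mono_on {0<..} h"
    using assms anti pos by (auto simp: mono_on_def less_imp_le intro!: powr_mono2)
  have lim: "Lim (at_right x) h = - (n x powr \<rho>)" if x: "0 < x" for x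
  proof (intro tendsto_Lim)
    have "(n \<longlongrightarrow> n x) (at_right x)"
      using tendsto_at[OF x] by (rule filterlim_mono) (auto simp: at_le)
    then have "((\<lambda>t. - (n t powr \<rho>)) \<longlongrightarrow> - (n x powr \<rho>)) (at_right x)"
      using pos[OF x] by (intro tendsto_intros) auto
    moreover have "eventually (\<lambda>t. - (n t powr \<rho>) = h t) (at_right x)"
      using eventually_at_right_less[of x] x assms(4) by (auto elim!: eventually_mono)
    ultimately show "(h \<longlongrightarrow> - (n x powr \<rho>)) (at_right x)"
      by (rule Lim_transform_eventually)
  qed simp
  show ?thesis
    using assms by (subst emeasure_stieltjes_Ioc[OF mono]) (auto simp: lim)
qed

section \<open>Monotone functions, and integrals and norms over subsets of the half-line\<close>

lemma borel_measurable_mono_ennreal: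
  fixes f :: "real \<Rightarrow> ennreal"
  assumes "mono f"
  shows "f \<in> borel_measurable borel"
proof (rule borel_measurableI_le)
  fix y
  have "is_interval {x. f x \<le> y}"
    unfolding is_interval_1 using monoD[OF assms] order_trans by blast
  then show "{x \<in> space borel. f x \<le> y} \<in> sets borel"
    by (simp add: real_interval_borel_measurable)
qed

lemma borel_measurable_indicator_lebesgue_on:
  assumes "A \<in> sets lebesgue"
  shows "indicator A \<in> borel_measurable (lebesgue_on B)"
  using assms by (intro measurable_restrict_space1 borel_measurable_indicator)

lemma nn_integral_lebesgue_on_subset:
  assumes "A \<subseteq> B" "A \<in> sets lebesgue" "B \<in> sets lebesgue"
  shows "(\<integral>\<^sup>+x. f x \<partial>lebesgue_on A) = (\<integral>\<^sup>+x\<in>A. f x \<partial>lebesgue_on B)"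
proof -
  have "f x * indicator A x = f x * indicator A x * indicator B x" for x
    using assms(1) by (auto simp: indicator_def)
  then show ?thesis
    using assms by (simp add: nn_integral_restrict_space)
qed

lemma nn_integral_lebesgue_on_mono:
  assumes "A \<subseteq> B" "A \<in> sets lebesgue" "B \<in> sets lebesgue"
  shows "(\<integral>\<^sup>+x. f x \<partial>lebesgue_on A) \<le> (\<integral>\<^sup>+x. f x \<partial>lebesgue_on B)"
  unfolding nn_integral_lebesgue_on_subset[OF assms]
  by (intro nn_integral_mono) (auto simp: indicator_def)

lemma nn_integral_lebesgue_on_UN:
  fixes I :: "'i set"
  assumes "countable I" "disjoint_family_on X I" "\<And>i. i \<in> I \<Longrightarrow> X i \<in> sets lebesgue"
    and "f \<in> borel_measurable (lebesgue_on (\<Union>(X ` I)))"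
  shows "(\<integral>\<^sup>+x. f x \<partial>lebesgue_on (\<Union>(X ` I))) = (\<integral>\<^sup>+i. (\<integral>\<^sup>+x. f x \<partial>lebesgue_on (X i)) \<partial>count_space I)"
proof -
  let ?B = "\<Union>(X ` I)"
  have B: "?B \<in> sets lebesgue" using assms by (intro sets.countable_UN'') auto
  have X: "X i \<in> sets (lebesgue_on ?B)" if "i \<in> I" for i
    using that assms(3) B by (subst sets_restrict_space_iff) auto
  have "(\<integral>\<^sup>+x. f x \<partial>lebesgue_on ?B) = (\<integral>\<^sup>+x\<in>?B. f x \<partial>lebesgue_on ?B)"
    using B by (intro nn_integral_lebesgue_on_subset) auto
  also have "\<dots> = (\<integral>\<^sup>+i. (\<integral>\<^sup>+x\<in>X i. f x \<partial>lebesgue_on ?B) \<partial>count_space I)"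
    by (intro nn_integral_count_space_UN assms X)
  also have "\<dots> = (\<integral>\<^sup>+i. (\<integral>\<^sup>+x. f x \<partial>lebesgue_on (X i)) \<partial>count_space I)"
    using B assms(3) by (intro nn_integral_cong nn_integral_lebesgue_on_subset[symmetric]) auto
  finally show ?thesis .
qed

lemma Lnorm_mono_set:
  assumes "A \<subseteq> B" "A \<in> sets lebesgue" "B \<in> sets lebesgue"
    and "f \<in> borel_measurable (lebesgue_on B)"
  shows "Lnorm p A f \<le> Lnorm p B f"
proof (cases "p = \<infinity>")
  case True
  have "AE x in lebesgue_on B. f x \<le> esssup (lebesgue_on B) f" by (rule esssup_AE)
  then have "AE x in lebesgue_on A. f x \<le> esssup (lebesgue_on B) f"
    using assms by (subst AE_restrict_space_iff, simp, subst (asm) AE_restrict_space_iff) (auto elim!: eventually_mono)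
  moreover have "f \<in> borel_measurable (lebesgue_on A)"
    using assms(4,1) by (rule measurable_restrict_mono)
  ultimately show ?thesis using True by (auto simp: Lnorm_def)
next
  case False
  then show ?thesis using assms
    by (auto simp: Lnorm_def intro!: epowr_mono nn_integral_lebesgue_on_mono)
qed

lemma Lnorm_empty [simp]: "Lnorm p {} f = 0"
proof (cases "p = \<infinity>")
  case True
  have "f \<in> borel_measurable (lebesgue_on {})" by (auto simp: measurable_def space_restrict_space sets_restrict_space)
  then have "esssup (lebesgue_on {}) f \<le> 0" by (intro esssup_I) (simp_all add: AE_restrict_space_iff)
  then show ?thesis using True by (simp add: Lnorm_def)
next
  case False
  have "(\<integral>\<^sup>+x. f x epowr enn2real p \<partial>lebesgue_on {}) = 0"
    by (simp add: nn_integral_restrict_space)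
  then show ?thesis using False by (simp add: Lnorm_def)
qed

text \<open>For a base point \<open>s > 0\<close> the measure with density \<open>f\<close> on
  \<open>{s<..}\<close> is finite and has distribution function \<open>n s - n t\<close>.
  Monotonicity, the limit and continuity are read off from it, continuity because points are null
  sets. The base point must be positive, since the integral over the whole half-line may be
  infinite.\<close>

lemma tail_function_integral:
  fixes f :: "real \<Rightarrow> ennreal"
  assumes f: "f \<in> borel_measurable (lebesgue_on {0<..})"
    and N: "\<And>t. 0 < t \<Longrightarrow> (\<integral>\<^sup>+x. f x \<partial>lebesgue_on {t<..}) = ennreal (n t) \<and> 0 < n t"
  shows "tail_function n"
proof -
  have Ioi: "(\<integral>\<^sup>+x. f x \<partial>lebesgue_on {s<..t}) + ennreal (n t) = ennreal (n s)" if "0 < s" "s \<le> t" for s t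
  proof -
    have fs: "f \<in> borel_measurable (lebesgue_on {s<..})"
      using measurable_restrict_mono[OF f, of "{s<..}"] that by auto
    have 1: "(\<integral>\<^sup>+x. f x \<partial>lebesgue_on A) = (\<integral>\<^sup>+x. f x * indicator A x \<partial>lebesgue_on {s<..})"
      if "A \<subseteq> {s<..}" "A \<in> sets borel" for A
      using that by (intro nn_integral_lebesgue_on_subset) auto
    have "(\<integral>\<^sup>+x. f x \<partial>lebesgue_on {s<..t}) + (\<integral>\<^sup>+x. f x \<partial>lebesgue_on {t<..})
       = (\<integral>\<^sup>+x. f x * indicator {s<..t} x + f x * indicator {t<..} x \<partial>lebesgue_on {s<..})"
      using that fs by (subst (1 2) 1) (auto intro!: nn_integral_add[symmetric]
          borel_measurable_times_ennreal borel_measurable_indicator_lebesgue_on)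
    also have "\<dots> = (\<integral>\<^sup>+x. f x \<partial>lebesgue_on {s<..})"
      using that by (intro nn_integral_cong) (auto simp: indicator_def space_restrict_space)
    finally show ?thesis using N[of s] N[of t] that by simp
  qed
  define M where "M s = distr (density (lebesgue_on {s<..}) f) borel (\<lambda>x. x)" for s :: real
  have meas: "(\<lambda>x. x) \<in> density (lebesgue_on {s<..}) f \<rightarrow>\<^sub>M borel" for s :: real
    by (auto intro!: measurable_restrict_space1 measurable_completion)
  have emeasure_M: "emeasure (M s) A = (\<integral>\<^sup>+x. f x * indicator A x \<partial>lebesgue_on {s<..})"
    if "0 < s" "A \<in> sets borel" for s A
  proof -
    have fs: "f \<in> borel_measurable (lebesgue_on {s<..})"
      using measurable_restrict_mono[OF f, of "{s<..}"] that by auto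
    have "emeasure (M s) A = emeasure (density (lebesgue_on {s<..}) f) (A \<inter> {s<..})"
      unfolding M_def using that by (subst emeasure_distr[OF meas]) (auto simp: space_restrict_space)
    also have "\<dots> = (\<integral>\<^sup>+x. f x * indicator (A \<inter> {s<..}) x \<partial>lebesgue_on {s<..})"
      using that fs by (subst emeasure_density) (auto simp: sets_restrict_space_iff)
    also have "\<dots> = (\<integral>\<^sup>+x. f x * indicator A x \<partial>lebesgue_on {s<..})"
      by (intro nn_integral_cong) (auto simp: indicator_def space_restrict_space)
    finally show ?thesis .
  qed
  have space_M: "emeasure (M s) UNIV = ennreal (n s)" if "0 < s" for s
    using emeasure_M[OF that, of UNIV] N[OF that] by simp
  have fin: "finite_borel_measure (M s)" if "0 < s" for s
    using space_M[OF that]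
    by (intro finite_borel_measure.intro finite_measureI finite_borel_measure_axioms.intro)
      (simp_all add: M_def)
  have cdf_M: "cdf (M s) t = n s - n t" if "0 < s" "s \<le> t" for s t
  proof -
    have "emeasure (M s) {..t} = (\<integral>\<^sup>+x. f x \<partial>lebesgue_on {s<..t})"
      unfolding emeasure_M[OF that(1) atMost_borel]
      by (subst nn_integral_lebesgue_on_subset[of _ "{s<..}"])
        (auto intro!: nn_integral_cong simp: indicator_def space_restrict_space)
    moreover have "(\<integral>\<^sup>+x. f x \<partial>lebesgue_on {s<..t}) = ennreal (n s) - ennreal (n t)"
      using Ioi[OF that] by (metis ennreal_add_diff_cancel_right ennreal_neq_top)
    moreover have "n t \<le> n s"
    proof -
      have "ennreal (n t) \<le> ennreal (n s)" unfolding Ioi[OF that, symmetric] by simp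
      then show ?thesis using N[of s] N[of t] that by (subst (asm) ennreal_le_iff) auto
    qed
    ultimately show ?thesis
      using N[of t] that by (simp add: cdf_def measure_def ennreal_minus)
  qed
  show ?thesis
  proof
    show "0 < n t" if "0 < t" for t using N[OF that] by simp
    show "n t \<le> n s" if "0 < s" "s \<le> t" for s t
      using finite_borel_measure.cdf_nonneg[OF fin, of s t] cdf_M[OF that] that by simp
    have "(cdf (M 1) \<longlongrightarrow> n 1) at_top"
      using finite_borel_measure.cdf_lim_at_top[OF fin, of 1] space_M[of 1] N[of 1]
      by (simp add: measure_def M_def)
    then have "((\<lambda>t. n 1 - cdf (M 1) t) \<longlongrightarrow> n 1 - n 1) at_top"
      by (intro tendsto_intros)
    moreover have "eventually (\<lambda>t. n 1 - cdf (M 1) t = n t) at_top"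
      using eventually_ge_at_top[of "1::real"] by eventually_elim (simp add: cdf_M)
    ultimately show "(n \<longlongrightarrow> 0) at_top"
      by (auto elim: Lim_transform_eventually)
    have "isCont n x" if "0 < x" for x
    proof -
      \<comment> \<open>The base point \<open>x / 2\<close> makes the formula for the distribution
        function valid in a neighbourhood of \<open>x\<close>.\<close>
      have "emeasure (M (x / 2)) {x} = 0"
      proof -
        have "AE y in lebesgue_on {x/2<..}. y \<noteq> x"
          using AE_completion[OF AE_lborel_singleton[of x]]
          by (subst AE_restrict_space_iff) (auto elim: eventually_mono)
        then have "AE y in lebesgue_on {x/2<..}. f y * indicator {x} y = 0"
          by eventually_elim simp
        then have "(\<integral>\<^sup>+y. f y * indicator {x} y \<partial>lebesgue_on {x/2<..}) = (\<integral>\<^sup>+y. 0 \<partial>lebesgue_on {x/2<..})"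
          by (rule nn_integral_cong_AE)
        then show ?thesis using that by (simp add: emeasure_M)
      qed
      then have "isCont (cdf (M (x / 2))) x"
        using that by (subst finite_borel_measure.isCont_cdf[OF fin]) (simp_all add: measure_def)
      then have "isCont (\<lambda>t. n (x / 2) - cdf (M (x / 2)) t) x"
        by (intro continuous_intros)
      moreover have "eventually (\<lambda>t. n (x / 2) - cdf (M (x / 2)) t = n t) (nhds x)"
      proof -
        have "eventually (\<lambda>t. x / 2 < t) (nhds x)"
          using that by (intro order_tendstoD[OF filterlim_ident]) simp
        then show ?thesis by eventually_elim (use that in \<open>simp add: cdf_M\<close>)
      qed
      ultimately show ?thesis by (subst (asm) isCont_cong) auto
    qed
    then show "continuous_on {0<..} n"
      by (intro continuous_at_imp_continuous_on) auto
  qed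
qed

section \<open>The weighted Hardy inequality\<close>

abbreviation half_line :: "real measure" where "half_line \<equiv> lebesgue_on {0<..}"

lemma id_half_line: "(\<lambda>x. x) \<in> half_line \<rightarrow>\<^sub>M borel"
  by (auto intro!: measurable_restrict_space1 measurable_completion)

text \<open>\<open>K\<close> and its inequality are parameters because the constant depends on
  \<open>q / a\<close> only: it is fixed before the weights, which makes the final bounds uniform in
  them.\<close>

locale weighted_Hardy =
  fixes a p q K :: real and w u :: "real \<Rightarrow> ennreal"
  assumes a: "0 < a" "a \<le> p" and q: "0 < q" and K: "0 < K"
    and discrete_Hardy_bound: "\<And>B :: int \<Rightarrow> ennreal.
      (\<integral>\<^sup>+k. ennreal (2 powr - real_of_int k) * (\<integral>\<^sup>+j. B j \<partial>count_space {..k}) epowr (q / a) \<partial>count_space UNIV)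
        \<le> ennreal K * (\<integral>\<^sup>+k. ennreal (2 powr - real_of_int k) * B k epowr (q / a) \<partial>count_space UNIV)"
    and w: "w \<in> borel_measurable half_line"
    and u: "u \<in> borel_measurable half_line"
    and u_tail: "\<And>t. 0 < t \<Longrightarrow> 0 < (\<integral>\<^sup>+x. u x epowr q \<partial>lebesgue_on {t<..})
      \<and> (\<integral>\<^sup>+x. u x epowr q \<partial>lebesgue_on {t<..}) < \<infinity>"
begin

definition n :: "real \<Rightarrow> real"
  where "n t = enn2real (\<integral>\<^sup>+x. u x epowr q \<partial>lebesgue_on {t<..})"

lemma n: "0 < t \<Longrightarrow> (\<integral>\<^sup>+x. u x epowr q \<partial>lebesgue_on {t<..}) = ennreal (n t) \<and> 0 < n t"
  using u_tail[of t] by (auto simp: n_def enn2real_positive_iff)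

sublocale tail_function n
  by (rule tail_function_integral[OF _ n]) (use u in measurable)

definition \<mu> :: "real measure" where "\<mu> = density half_line (\<lambda>x. u x epowr q)"

definition s :: ennreal where "s = ennreal p \<leadsto> ennreal a"

definition V :: "real \<Rightarrow> ennreal" where "V t = Lnorm s {0<..<t} w"

text \<open>Discrete counterpart of \<open>V\<close>: \<open>V t \<le> e k\<close> on
  \<open>slice k\<close>, and \<open>e k \<le> V t\<close> on \<open>slice (k + 1)\<close>.\<close>

definition e :: "int \<Rightarrow> ennreal" where "e k = Lnorm s (initial k) w"

text \<open>\<open>F\<close> and \<open>G\<close> are powers of norms and not norms, so that they
  add up over disjoint sets, in particular over slices.\<close>

definition F :: "(real \<Rightarrow> ennreal) \<Rightarrow> real set \<Rightarrow> ennreal"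
  where "F y A = (\<integral>\<^sup>+x. (y x * w x) epowr a \<partial>lebesgue_on A)"

definition G :: "(real \<Rightarrow> ennreal) \<Rightarrow> real set \<Rightarrow> ennreal"
  where "G y A = (\<integral>\<^sup>+x. y x epowr p \<partial>lebesgue_on A)"

definition ces :: "(real \<Rightarrow> ennreal) \<Rightarrow> ennreal"
  where "ces y = Ces_norm (ennreal a) (ennreal q) u w y"

lemma p: "0 < p" using a by simp

lemma borel_lebesgue: "A \<in> sets borel \<Longrightarrow> A \<in> sets lebesgue" by simp

lemma sets_\<mu>: "sets \<mu> = sets half_line" by (simp add: \<mu>_def)

lemma emeasure_\<mu>: "A \<in> sets borel \<Longrightarrow> A \<subseteq> {0<..} \<Longrightarrow> emeasure \<mu> A = (\<integral>\<^sup>+x. u x epowr q \<partial>lebesgue_on A)"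
  unfolding \<mu>_def using u
  by (subst emeasure_density) (auto simp: sets_restrict_space_iff nn_integral_lebesgue_on_subset[of A "{0<..}"])

lemma emeasure_\<mu>_Ioc:
  assumes "0 < b" "b \<le> c"
  shows "emeasure \<mu> {b<..c} = ennreal (n b powr 1 - n c powr 1)"
proof -
  have "{b<..} = {b<..c} \<union> {c<..}" "{b<..c} \<inter> {c<..} = {}" using assms by auto
  moreover have "{b<..c} \<in> sets \<mu>" "{c<..} \<in> sets \<mu>"
    unfolding sets_\<mu> using assms by (auto simp: sets_restrict_space_iff)
  ultimately have "emeasure \<mu> {b<..} = emeasure \<mu> {b<..c} + emeasure \<mu> {c<..}"
    using plus_emeasure[of "{b<..c}" \<mu> "{c<..}"] by simp
  moreover have "emeasure \<mu> {b<..} = ennreal (n b)" "emeasure \<mu> {c<..} = ennreal (n c)"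
    using assms n[of b] n[of c] by (subst emeasure_\<mu>; force)+
  ultimately have "emeasure \<mu> {b<..c} = ennreal (n b) - ennreal (n c)"
    by (metis ennreal_add_diff_cancel_right ennreal_neq_top)
  then show ?thesis using n[of b] n[of c] assms by (simp add: ennreal_minus)
qed

lemma F_measurable: "y \<in> borel_measurable half_line \<Longrightarrow> (\<lambda>x. (y x * w x) epowr a) \<in> borel_measurable half_line"
  by (intro borel_measurable_epowr borel_measurable_times_ennreal w)

lemma F_mono:
  assumes "A \<subseteq> B" "A \<in> sets borel" "B \<in> sets borel"
  shows "F y A \<le> F y B"
  unfolding F_def using assms by (intro nn_integral_lebesgue_on_mono) auto

lemma F_mono_fun: "(\<And>x. x \<in> A \<Longrightarrow> A \<in> sets borel \<Longrightarrow> y x \<le> z x) \<Longrightarrow> A \<in> sets borel \<Longrightarrow> F y A \<le> F z A"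
  unfolding F_def using a
  by (intro nn_integral_mono epowr_mono mult_right_mono) (auto simp: space_restrict_space)

lemma F_Ioo_measurable: "(\<lambda>t. F y {0<..<t} epowr c) \<in> borel_measurable borel" if "0 \<le> c"
  using that by (intro borel_measurable_mono_ennreal monoI epowr_mono F_mono) auto

lemma F_Ioo_measurable_half_line: "(\<lambda>t. F y {0<..<t} epowr c) \<in> borel_measurable half_line" if "0 \<le> c"
  using measurable_compose[OF id_half_line F_Ioo_measurable[OF that]] by simp

text \<open>The power \<open>q\<close> removes the outer root and moves the weight
  \<open>u powr q\<close> into the measure \<open>\<mu>\<close>, whose mass on slices is
  known.\<close>

lemma ces_epowr: "ces y epowr q = (\<integral>\<^sup>+t. F y {0<..<t} epowr (q / a) \<partial>\<mu>)"
proof -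
  have "ces y epowr q = (\<integral>\<^sup>+t. (F y {0<..<t} epowr (1 / a) * u t) epowr q \<partial>half_line)"
    using a q by (simp add: ces_def Ces_norm_def Lnorm_w_def Lnorm_ennreal F_def epowr_epowr)
  also have "\<dots> = (\<integral>\<^sup>+t. u t epowr q * F y {0<..<t} epowr (q / a) \<partial>half_line)"
    using a q by (simp add: epowr_mult epowr_epowr mult.commute)
  also have "\<dots> = (\<integral>\<^sup>+t. F y {0<..<t} epowr (q / a) \<partial>\<mu>)"
    unfolding \<mu>_def using u a q
    by (intro nn_integral_density[symmetric] F_Ioo_measurable_half_line) auto
  finally show ?thesis .
qed

lemma F_le: 
  assumes "A \<in> sets borel" "A \<subseteq> {0<..}" "y \<in> borel_measurable half_line"
  shows "F y A \<le> Lnorm s A w epowr a * G y A epowr (a / p)"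
  unfolding F_def G_def s_def using assms w measurable_restrict_mono[of _ lebesgue "{0<..}" borel A]
  by (intro nn_integral_Lnorm_Holder a) auto

lemma F_initial:
  assumes "y \<in> borel_measurable half_line"
  shows "F y (initial k) = (\<integral>\<^sup>+j. F y (slice j) \<partial>count_space {..k})"
  unfolding F_def initial_eq
  by (intro nn_integral_lebesgue_on_UN disjoint_slice
      measurable_restrict_mono[OF F_measurable[OF assms]])
    (auto simp: slice_def[abs_def] intro: borel_lebesgue slice_borel[unfolded slice_def])

lemma G_slices:
  assumes "y \<in> borel_measurable half_line"
  shows "(\<integral>\<^sup>+k. G y (slice k) \<partial>count_space UNIV) = G y {0<..}"
proof -
  have "(\<lambda>x. y x epowr p) \<in> borel_measurable half_line" using assms by measurable
  then show ?thesis
    unfolding G_def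
    using nn_integral_lebesgue_on_UN[of UNIV slice "\<lambda>x. y x epowr p"]
    by (simp add: UN_slice disjoint_slice borel_lebesgue)
qed

lemma Lnorm_slice_le: "Lnorm s (slice k) w \<le> e k"
  unfolding e_def
  by (rule Lnorm_mono_set)
    (auto simp: borel_lebesgue initial_eq[of k] intro!: measurable_restrict_mono[OF w] dest: subsetD[OF initial_subset] subsetD[OF slice_subset])

text \<open>Common source of both upper bounds; the factor 2 is the constant of
  \<open>emeasure_slice_le\<close> for \<open>\<rho> = 1\<close>. The two cases differ only in how
  the products of \<open>e k\<close> and \<open>G y (slice k)\<close> are separated
  afterwards.\<close>

lemma ces_le_slices:
  assumes y: "y \<in> borel_measurable half_line"
  shows "ces y epowr q \<le> ennreal (2 * K) *
    (\<integral>\<^sup>+k. ennreal (2 powr - real_of_int k) * (e k epowr q * G y (slice k) epowr (q / p)) \<partial>count_space UNIV)"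
proof -
  have "ces y epowr q \<le> (\<integral>\<^sup>+k. F y (initial k) epowr (q / a) * ennreal (2 powr 1 * 2 powr (- real_of_int k * 1)) \<partial>count_space UNIV)"
    unfolding ces_epowr
  proof (rule nn_integral_le_slices)
    show "(\<lambda>t. F y {0<..<t} epowr (q / a)) \<in> borel_measurable \<mu>"
      using F_Ioo_measurable_half_line[of "q / a" y] a q by (simp add: \<mu>_def)
    show "F y {0<..<t} epowr (q / a) \<le> F y (initial k) epowr (q / a)" if "t \<in> slice k" for k t
      using Ioo_subset_initial[OF that] a q by (intro epowr_mono F_mono) auto
  qed (use sets_\<mu> emeasure_\<mu>_Ioc in auto)
  also have "\<dots> = (\<integral>\<^sup>+k. 2 * (ennreal (2 powr - real_of_int k) * F y (initial k) epowr (q / a)) \<partial>count_space UNIV)"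
    by (intro nn_integral_cong) (simp add: ennreal_mult mult_ac)
  also have "\<dots> = 2 * (\<integral>\<^sup>+k. ennreal (2 powr - real_of_int k) * (\<integral>\<^sup>+j. F y (slice j) \<partial>count_space {..k}) epowr (q / a) \<partial>count_space UNIV)"
    by (simp add: nn_integral_cmult F_initial[OF y])
  also have "\<dots> \<le> 2 * (ennreal K * (\<integral>\<^sup>+k. ennreal (2 powr - real_of_int k) * F y (slice k) epowr (q / a) \<partial>count_space UNIV))"
    by (intro mult_left_mono discrete_Hardy_bound) auto
  also have "\<dots> = ennreal (2 * K) * (\<integral>\<^sup>+k. ennreal (2 powr - real_of_int k) * F y (slice k) epowr (q / a) \<partial>count_space UNIV)"
    using K by (simp add: ennreal_mult mult.assoc)
  also have "\<dots> \<le> ennreal (2 * K) *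
    (\<integral>\<^sup>+k. ennreal (2 powr - real_of_int k) * (e k epowr q * G y (slice k) epowr (q / p)) \<partial>count_space UNIV)"
  proof (intro mult_left_mono nn_integral_mono)
    fix k
    \<comment> \<open>The norm of \<open>w\<close> over the slice is enlarged to the one over
      \<open>initial k\<close>, the quantity that is comparable with \<open>V\<close>.\<close>
    have "F y (slice k) \<le> e k epowr a * G y (slice k) epowr (a / p)"
      using F_le[OF slice_borel slice_subset y, of k]
      by (rule order_trans) (use a in \<open>intro mult_right_mono epowr_mono Lnorm_slice_le, auto\<close>)
    then have "F y (slice k) epowr (q / a) \<le> (e k epowr a * G y (slice k) epowr (a / p)) epowr (q / a)"
      using a q by (intro epowr_mono) auto
    then show "F y (slice k) epowr (q / a) \<le> e k epowr q * G y (slice k) epowr (q / p)"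
      using a q by (simp add: epowr_mult epowr_epowr)
  qed auto
  finally show ?thesis .
qed

section \<open>The supremum as upper and lower bound\<close>

lemma e_le_V: "initial k \<subseteq> {0<..<t} \<Longrightarrow> e k \<le> V t"
  unfolding e_def V_def
  by (intro Lnorm_mono_set measurable_restrict_mono[OF w]) (auto simp: borel_lebesgue)

lemma e_empty: "initial k = {} \<Longrightarrow> e k = 0"
  by (simp add: e_def)

lemma ces_le_Sup:
  assumes pq: "p \<le> q" and y: "y \<in> borel_measurable half_line"
    and D: "\<And>t. 0 < t \<Longrightarrow> V t * ennreal (n t powr (1 / q)) \<le> D"
  shows "ces y \<le> ennreal ((4 * K) powr (1 / q)) * D * G y {0<..} epowr (1 / p)"
proof -
  \<comment> \<open>\<open>D\<close> is tested at a right bound \<open>t\<close> of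
    \<open>initial k\<close> where \<open>n t\<close> is half of \<open>2 powr - k\<close>; the lost
    factor 2 turns the \<open>2 * K\<close> of \<open>ces_le_slices\<close> into
    \<open>4 * K\<close>.\<close>
  have ek: "ennreal (2 powr - real_of_int k) * e k epowr q \<le> 2 * D epowr q" for k
  proof (cases "initial k = {}")
    case False
    then obtain t where t: "0 < t" "n t = 2 powr (- real_of_int k - 1)" "initial k \<subseteq> {0<..<t}"
      by (rule initial_less_ex)
    have nt: "2 * n t = 2 powr - real_of_int k"
      using powr_add[of 2 1 "- real_of_int k - 1"] t by simp
    have "(e k * ennreal (n t powr (1 / q))) epowr q \<le> D epowr q"
      using q order_trans[OF mult_right_mono[OF e_le_V[OF t(3)]] D[OF t(1)]]
      by (intro epowr_mono) auto
    then have "e k epowr q * ennreal (n t) \<le> D epowr q"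
      using q pos[OF t(1)] by (simp add: epowr_mult epowr_ennreal powr_powr)
    then have "2 * (e k epowr q * ennreal (n t)) \<le> 2 * D epowr q"
      by (intro mult_left_mono) auto
    moreover have "ennreal (2 powr - real_of_int k) = 2 * ennreal (n t)"
      using pos[OF t(1)] by (simp add: nt[symmetric] ennreal_mult)
    ultimately show ?thesis by (simp add: mult_ac)
  qed (simp add: e_empty)
  have "ces y epowr q \<le> ennreal (2 * K) *
      (\<integral>\<^sup>+k. ennreal (2 powr - real_of_int k) * (e k epowr q * G y (slice k) epowr (q / p)) \<partial>count_space UNIV)"
    by (rule ces_le_slices[OF y])
  also have "\<dots> \<le> ennreal (2 * K) * (\<integral>\<^sup>+k. 2 * D epowr q * G y (slice k) epowr (q / p) \<partial>count_space UNIV)"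
    using ek by (intro mult_left_mono nn_integral_mono) (auto simp: mult.assoc[symmetric] intro: mult_right_mono)
  also have "\<dots> = ennreal (2 * K) * (2 * D epowr q * (\<integral>\<^sup>+k. G y (slice k) epowr (q / p) \<partial>count_space UNIV))"
    by (subst nn_integral_cmult) auto
  also have "\<dots> \<le> ennreal (2 * K) * (2 * D epowr q * G y {0<..} epowr (q / p))"
    unfolding G_slices[OF y, symmetric]
    using p pq by (intro mult_left_mono nn_integral_epowr_le_count_space) auto
  also have "\<dots> = (ennreal ((4 * K) powr (1 / q)) * D * G y {0<..} epowr (1 / p)) epowr q"
  proof -
    have "ennreal (2 * K) * 2 = ennreal (4 * K)"
      using K ennreal_mult[of "2 * K" 2] by simp
    then show ?thesis
      using q K by (simp add: epowr_mult epowr_epowr epowr_ennreal powr_powr mult.assoc[symmetric])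
  qed
  finally show ?thesis using q by (simp add: epowr_le_iff)
qed

text \<open>A near-extremal on \<open>A\<close> is extended by 0. The alternative
  \<open>b = 0\<close> covers sets on which \<open>w\<close> has norm 0, where no smaller
  \<open>b\<close> exists.\<close>

lemma ex_extremal:
  assumes A: "A \<in> sets borel" "A \<subseteq> {0<..}" and b: "b < Lnorm s A w \<or> b = 0"
  shows "\<exists>y\<in>borel_measurable half_line. G y {0<..} \<le> 1 \<and> b epowr a \<le> F y A"
proof (cases "b = 0")
  case True
  then show ?thesis by (intro bexI[of _ "\<lambda>x. 0"]) (auto simp: G_def)
next
  case False
  have "w \<in> borel_measurable (lebesgue_on A)"
    by (rule measurable_restrict_mono[OF w A(2)])
  with nn_integral_Lnorm_Holder_sharp[OF a, of A w b] False A b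
  obtain z where z: "z \<in> borel_measurable (lebesgue_on A)"
    "(\<integral>\<^sup>+x. z x epowr p \<partial>lebesgue_on A) \<le> 1"
    "b epowr a \<le> (\<integral>\<^sup>+x. (z x * w x) epowr a \<partial>lebesgue_on A)"
    unfolding s_def by auto
  define y where "y x = z x * indicator A x" for x
  have "y \<in> borel_measurable lebesgue"
    using z(1) A unfolding y_def by (subst (asm) borel_measurable_restrict_space_iff_ennreal) auto
  then have y: "y \<in> borel_measurable half_line" by (rule measurable_restrict_space1)
  have "G y {0<..} = (\<integral>\<^sup>+x. z x epowr p \<partial>lebesgue_on A)"
    unfolding G_def y_def using A
    by (subst nn_integral_lebesgue_on_subset[of A "{0<..}"])
      (auto intro!: nn_integral_cong simp: indicator_def)
  moreover have "b epowr a \<le> F y A"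
    using z(3) unfolding F_def y_def
    by (rule order_trans) (auto intro!: nn_integral_mono simp: space_restrict_space)
  ultimately show ?thesis using z(2) y by (intro bexI[of _ y]) auto
qed

text \<open>A near-extremal on \<open>(0,t)\<close> has inner norm at least \<open>b\<close> at
  every \<open>x > t\<close>, and integrating over these \<open>x\<close> alone produces
  \<open>n t\<close>. For \<open>q < p\<close> the same estimate supplies the finiteness of
  \<open>e k\<close>.\<close>

lemma V_mult_le:
  assumes C: "\<And>y. y \<in> borel_measurable half_line \<Longrightarrow> G y {0<..} < \<infinity> \<Longrightarrow> ces y \<le> C * G y {0<..} epowr (1 / p)"
    and t: "0 < t"
  shows "V t * ennreal (n t powr (1 / q)) \<le> C"
proof -
  have "b * ennreal (n t powr (1 / q)) \<le> C" if b: "b < V t" for b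
  proof -
    let ?A = "{0<..<t}"
    have "?A \<subseteq> {0<..}" by auto
    then obtain y where y: "y \<in> borel_measurable half_line" and G: "G y {0<..} \<le> 1"
      and "b epowr a \<le> F y ?A"
      using ex_extremal[of ?A b] b unfolding V_def by auto
    then have F: "b epowr q \<le> F y ?A epowr (q / a)"
      using epowr_mono[of "b epowr a" "F y ?A" "q / a"] a q by (simp add: epowr_epowr)
    have "b epowr q * ennreal (n t) = b epowr q * emeasure \<mu> {t<..}"
      using n[OF t] t by (subst emeasure_\<mu>) auto
    also have "\<dots> = (\<integral>\<^sup>+x. b epowr q * indicator {t<..} x \<partial>\<mu>)"
      using t by (subst nn_integral_cmult_indicator) (auto simp: sets_\<mu> sets_restrict_space_iff)
    also have "\<dots> \<le> ces y epowr q"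
      unfolding ces_epowr
    proof (rule nn_integral_mono)
      fix x
      show "b epowr q * indicator {t<..} x \<le> F y {0<..<x} epowr (q / a)"
      proof (cases "t < x")
        case True
        then have "F y ?A epowr (q / a) \<le> F y {0<..<x} epowr (q / a)"
          using a q by (intro epowr_mono F_mono) auto
        with F show ?thesis using True by simp
      qed simp
    qed
    also have "ces y epowr q \<le> (C * G y {0<..} epowr (1 / p)) epowr q"
      using q G by (intro epowr_mono C y) (auto simp: order.strict_trans1)
    also have "\<dots> \<le> (C * 1) epowr q"
      using q p epowr_mono[OF G, of "1 / p"] by (intro epowr_mono mult_left_mono) auto
    finally have "(b * ennreal (n t powr (1 / q))) epowr q \<le> C epowr q"
      using q n[OF t] by (simp add: epowr_mult epowr_ennreal powr_powr)
    then show ?thesis using q by (simp add: epowr_le_iff)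
  qed
  \<comment> \<open>Passing to the supremum over smaller \<open>b\<close> also covers
    \<open>V t = \<infinity>\<close>.\<close>
  then have "(SUP b\<in>{..<V t}. b) * ennreal (n t powr (1 / q)) \<le> C"
    by (subst SUP_mult_right_ennreal) (auto intro!: SUP_least)
  then show ?thesis by simp
qed

section \<open>The Stieltjes integral as upper and lower bound for \<open>q < p\<close>\<close>

lemma V_measurable: "V \<in> borel_measurable borel"
proof (intro borel_measurable_mono_ennreal monoI)
  fix b c :: real assume "b \<le> c"
  then show "V b \<le> V c"
    unfolding V_def
    by (intro Lnorm_mono_set measurable_restrict_mono[OF w]) auto
qed

definition r :: real where "r = 1 / (1 / q - 1 / p)"

definition h :: "real \<Rightarrow> real" where "h t = - enn2real (Lnorm (ennreal q) {t<..} u epowr r)"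

lemma Lnorm_u: "0 < t \<Longrightarrow> Lnorm (ennreal q) {t<..} u = ennreal (n t powr (1 / q))"
  using n[of t] q by (simp add: Lnorm_ennreal epowr_ennreal)

context
  assumes qp: "q < p"
begin

lemma r: "0 < r" "q / r = 1 - q / p" "r / p + 1 = r / q"
  using q qp by (auto simp: r_def field_simps)

lemma stieltjes_h:
  shows "0 < r / q" "sets (stieltjes h) = sets half_line \<or> sets (stieltjes h) = sets (restrict_space borel {0<..})"
    "\<And>b c. 0 < b \<Longrightarrow> b \<le> c \<Longrightarrow> emeasure (stieltjes h) {b<..c} = ennreal (n b powr (r / q) - n c powr (r / q))"
proof -
  show rq: "0 < r / q" using r q by simp
  show "sets (stieltjes h) = sets half_line \<or> sets (stieltjes h) = sets (restrict_space borel {0<..})"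
    by (simp add: sets_stieltjes)
  show "emeasure (stieltjes h) {b<..c} = ennreal (n b powr (r / q) - n c powr (r / q))" if "0 < b" "b \<le> c" for b c
    using rq that by (rule emeasure_stieltjes_tail)
      (use q r in \<open>auto simp: h_def Lnorm_u epowr_ennreal powr_powr\<close>)
qed

lemma V_epowr_measurable: "(\<lambda>t. V t epowr r) \<in> borel_measurable (stieltjes h)"
proof -
  have "(\<lambda>t. V t epowr r) \<in> borel_measurable borel"
    using V_measurable by (rule borel_measurable_epowr)
  then have "(\<lambda>t. V t epowr r) \<in> borel_measurable (restrict_space borel {0<..})"
    by (rule measurable_restrict_space1)
  then show ?thesis by (simp add: measurable_def sets_stieltjes sets_eq_imp_space_eq[OF sets_stieltjes])
qed

text \<open>Hoelder's inequality over the levels with weights \<open>q / r\<close> and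
  \<open>q / p\<close> separates the sum of \<open>ces_le_slices\<close> into powers of
  \<open>S\<close> and of \<open>G y {0<..}\<close>. Since \<open>e k \<le> V t\<close> on
  \<open>slice (k + 1)\<close>, \<open>S\<close> is dominated by the Stieltjes integral; the price
  is the constant of \<open>emeasure_slice_ge\<close> for \<open>\<rho> = r / q\<close>.\<close>

lemma ces_le_stieltjes:
  assumes y: "y \<in> borel_measurable half_line"
  shows "ces y \<le> ennreal ((2 * K) powr (1 / q) * (1 / (2 powr - (r / q) * (1 - (3/4) powr (r / q)))) powr (1 / r))
    * (\<integral>\<^sup>+t. V t epowr r \<partial>stieltjes h) epowr (1 / r) * G y {0<..} epowr (1 / p)"
proof -
  define c where "c = 2 powr - (r / q) * (1 - (3/4) powr (r / q))"
  define R where "R = (\<integral>\<^sup>+t. V t epowr r \<partial>stieltjes h)"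
  define S where "S = (\<integral>\<^sup>+k. e k epowr r * ennreal (2 powr (- real_of_int k * (r / q))) \<partial>count_space UNIV)"
  have c: "0 < c"
    using powr_less_mono2[of "r / q" "3/4" 1] stieltjes_h(1) by (simp add: c_def)
  have "ennreal c * S \<le> R"
    unfolding c_def S_def R_def
  proof (rule slices_le_nn_integral[OF stieltjes_h V_epowr_measurable])
    show "e k epowr r \<le> V t epowr r" if "t \<in> slice (k + 1)" for k t
      using e_le_V[OF initial_subset_Ioo[OF that]] r by (intro epowr_mono) auto
  qed (use e_empty in auto)
  then have "ennreal (1 / c) * (ennreal c * S) \<le> ennreal (1 / c) * R"
    by (intro mult_left_mono) auto
  moreover have "ennreal (1 / c) * ennreal c = 1"
    using c by (simp flip: ennreal_mult)
  ultimately have S: "S \<le> ennreal (1 / c) * R"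
    by (simp add: mult.assoc[symmetric])
  have qr: "0 < q / r" "q / r < 1" "0 < q / p" using r q qp by auto
  have "ces y epowr q \<le> ennreal (2 * K) *
      (\<integral>\<^sup>+k. ennreal (2 powr - real_of_int k) * (e k epowr q * G y (slice k) epowr (q / p)) \<partial>count_space UNIV)"
    by (rule ces_le_slices[OF y])
  \<comment> \<open>The weight \<open>2 powr - k\<close> goes entirely to the factor with
    \<open>e k\<close>, where its power \<open>r / q\<close> is the Stieltjes mass of a slice up to
    constants; the other factors then sum to \<open>G y {0<..}\<close>.\<close>
  also have "(\<lambda>k. ennreal (2 powr - real_of_int k) * (e k epowr q * G y (slice k) epowr (q / p)))
      = (\<lambda>k. (e k epowr r * ennreal (2 powr (- real_of_int k * (r / q)))) epowr (q / r) * G y (slice k) epowr (1 - q / r))"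
  proof
    fix k
    have "(e k epowr r * ennreal (2 powr (- real_of_int k * (r / q)))) epowr (q / r)
        = e k epowr q * ennreal (2 powr - real_of_int k)"
      using qr(1) q r(1) by (subst epowr_mult) (auto simp: epowr_epowr epowr_ennreal powr_powr)
    moreover have "1 - q / r = q / p" using r by simp
    ultimately show "ennreal (2 powr - real_of_int k) * (e k epowr q * G y (slice k) epowr (q / p))
      = (e k epowr r * ennreal (2 powr (- real_of_int k * (r / q)))) epowr (q / r) * G y (slice k) epowr (1 - q / r)"
      by (simp only: mult_ac)
  qed
  also have "ennreal (2 * K) * integral\<^sup>N (count_space UNIV) \<dots> \<le> ennreal (2 * K) * (S epowr (q / r) * G y {0<..} epowr (1 - q / r))"
    unfolding G_slices[OF y, symmetric] S_def
    by (intro mult_left_mono nn_integral_Holder qr) auto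
  also have "\<dots> \<le> ennreal (2 * K) * ((ennreal (1 / c) * R) epowr (q / r) * G y {0<..} epowr (q / p))"
    using S qr r by (intro mult_left_mono mult_mono epowr_mono) auto
  also have "\<dots> = (ennreal ((2 * K) powr (1 / q) * (1 / c) powr (1 / r)) * R epowr (1 / r) * G y {0<..} epowr (1 / p)) epowr q"
    using q K c qr
    by (simp add: epowr_mult epowr_epowr epowr_ennreal powr_powr powr_mult ennreal_mult mult.assoc)
  finally show ?thesis using q by (simp add: epowr_le_iff c_def R_def)
qed

text \<open>A test function for the levels in \<open>J\<close> gives
  \<open>S / 8 \<le> (C * S powr (1 / p)) powr q\<close> with \<open>S = sum A J\<close>. As
  \<open>S\<close> is finite, \<open>S powr (q / p)\<close> cancels and a bound independent of
  \<open>J\<close> remains. In the constant, \<open>2 powr (r / q)\<close> comes from the mass of a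
  slice, \<open>2 powr r\<close> from halving \<open>e k\<close>, and \<open>8 powr (r / q)\<close>
  from the 8 above.\<close>

lemma stieltjes_le:
  assumes C: "\<And>y. y \<in> borel_measurable half_line \<Longrightarrow> G y {0<..} < \<infinity> \<Longrightarrow> ces y \<le> C * G y {0<..} epowr (1 / p)"
  shows "(\<integral>\<^sup>+t. V t epowr r \<partial>stieltjes h) epowr (1 / r) \<le> ennreal ((2 powr (r / q) * 2 powr r * 8 powr (r / q)) powr (1 / r)) * C"
proof (cases "C = \<infinity>")
  case True
  then show ?thesis by (simp add: ennreal_mult_top)
next
  case False
  then obtain \<gamma> where \<gamma>: "C = ennreal \<gamma>" "0 \<le> \<gamma>" by (cases C) auto
  have e_finite: "e k < \<infinity>" for k
  proof (cases "initial k = {}")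
    case False
    then obtain t where t: "0 < t" "initial k \<subseteq> {0<..<t}" by (rule initial_less_ex)
    have "V t * ennreal (n t powr (1 / q)) < \<infinity>"
      using V_mult_le[OF C t(1)] \<gamma> by (auto intro: order.strict_trans1)
    then have "V t < \<infinity>"
      using pos[OF t(1)] by (auto simp: ennreal_mult_less_top ennreal_eq_0_iff)
    then show ?thesis using e_le_V[OF t(2)] by (rule order.strict_trans1[rotated])
  qed (simp add: e_empty)
  \<comment> \<open>The test function below glues near-extremals \<open>z k\<close> of Hoelder's inequality on \<open>initial k\<close> with
    weights \<open>A k powr (1 / p)\<close>; this \<open>A\<close> is the solution of
    \<open>A k = A k powr (q / p) * (e k / 2) powr q * 2 powr - k\<close>.\<close>
  define A where "A k = ennreal (2 powr (- real_of_int k * (r / q))) * (e k / 2) epowr r" for k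
  have A_finite: "A k < \<infinity>" for k
  proof -
    have "e k / 2 \<noteq> top"
      using e_finite[of k] by (auto simp: ennreal_divide_eq_top_iff)
    then have "A k \<noteq> top"
      by (auto simp: A_def ennreal_mult_eq_top_iff)
    then show ?thesis by (simp add: less_top)
  qed
  have "\<exists>z\<in>borel_measurable half_line. G z {0<..} \<le> 1 \<and> (e k / 2) epowr a \<le> F z (initial k)" for k
  proof (rule ex_extremal)
    \<comment> \<open>Halving gives strict inequality when \<open>e k\<close> is positive and
      finite; if \<open>e k = 0\<close>, the second alternative holds.\<close>
    show "e k / 2 < Lnorm s (initial k) w \<or> e k / 2 = 0"
    proof (cases "e k")
      case (real x)
      then have "e k / 2 = ennreal (x / 2)" by (simp add: divide_ennreal[of x 2, simplified])
      then show ?thesis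
        using real by (cases "x = 0") (auto simp: e_def[symmetric] ennreal_less_iff)
    qed (use e_finite[of k] in simp)
  qed (auto simp: initial_subset)
  then obtain z where z: "\<And>k. z k \<in> borel_measurable half_line" "\<And>k. G (z k) {0<..} \<le> 1"
    "\<And>k. (e k / 2) epowr a \<le> F (z k) (initial k)"
    by metis
  have sum_A: "sum A J \<le> ennreal (8 powr (r / q) * \<gamma> powr r)" if J: "finite J" for J
  proof -
    define S where "S = sum A J"
    \<comment> \<open>Adding \<open>p\<close>-th powers keeps \<open>G y {0<..}\<close> below
      \<open>S\<close>, while \<open>y\<close> still dominates each term
      \<open>A k powr (1 / p) * z k\<close>; the estimate at level \<open>k\<close> uses that term
      only.\<close>
    define y where "y x = (\<Sum>k\<in>J. A k * z k x epowr p) epowr (1 / p)" for x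
    have y: "y \<in> borel_measurable half_line"
      unfolding y_def using z(1) by (intro borel_measurable_epowr borel_measurable_sum) measurable
    have "G y {0<..} = (\<integral>\<^sup>+x. (\<Sum>k\<in>J. A k * z k x epowr p) \<partial>half_line)"
      using p by (simp add: G_def y_def epowr_epowr)
    also have "\<dots> = (\<Sum>k\<in>J. A k * G (z k) {0<..})"
      using z(1) by (simp add: nn_integral_sum nn_integral_cmult G_def)
    also have "\<dots> \<le> (\<Sum>k\<in>J. A k * 1)"
      using z(2) by (intro sum_mono mult_left_mono) auto
    finally have G: "G y {0<..} \<le> S" by (simp add: S_def)
    have S_finite: "S < \<infinity>" using A_finite J by (simp add: S_def)
    have AF: "A k \<le> F y (initial k) epowr (q / a) * ennreal (2 powr (- real_of_int k * 1))" if k: "k \<in> J" for k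
    proof -
      have "A k epowr (a / p) * (e k / 2) epowr a \<le> A k epowr (a / p) * F (z k) (initial k)"
        using z(3) by (intro mult_left_mono) auto
      also have "\<dots> = F (\<lambda>x. A k epowr (1 / p) * z k x) (initial k)"
      proof -
        have "(\<lambda>x. (z k x * w x) epowr a) \<in> borel_measurable (lebesgue_on (initial k))"
          by (rule measurable_restrict_mono[OF F_measurable[OF z(1)] initial_subset])
        then show ?thesis
          unfolding F_def using a
          by (subst nn_integral_cmult[symmetric]) (auto simp: epowr_mult epowr_epowr mult.assoc)
      qed
      also have "\<dots> \<le> F y (initial k)"
      proof (rule F_mono_fun)
        fix x
        have "A k * z k x epowr p \<le> (\<Sum>k\<in>J. A k * z k x epowr p)"
          using J k by (intro member_le_sum) auto
        then have "(A k * z k x epowr p) epowr (1 / p) \<le> y x"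
          unfolding y_def using p by (intro epowr_mono) auto
        then show "A k epowr (1 / p) * z k x \<le> y x"
          using p by (simp add: epowr_mult epowr_epowr)
      qed simp
      finally have "(A k epowr (a / p) * (e k / 2) epowr a) epowr (q / a) \<le> F y (initial k) epowr (q / a)"
        using a q by (intro epowr_mono) auto
      then have "A k epowr (q / p) * (e k / 2) epowr q * ennreal (2 powr (- real_of_int k * 1))
          \<le> F y (initial k) epowr (q / a) * ennreal (2 powr (- real_of_int k * 1))"
        using a q by (intro mult_right_mono) (auto simp: epowr_mult epowr_epowr)
      moreover have "A k epowr (q / p) * (e k / 2) epowr q * ennreal (2 powr (- real_of_int k * 1)) = A k"
      proof -
        have ex: "- real_of_int k * (r / q) * (q / p) + - real_of_int k * 1 = - real_of_int k * (r / q)"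
        proof -
          have "- real_of_int k * (r / q) * (q / p) + - real_of_int k * 1 = - real_of_int k * (r / p + 1)"
            using q by (simp add: algebra_simps)
          then show ?thesis by (simp only: r(3))
        qed
        have ex2: "r * (q / p) + q = r"
        proof -
          have "r * (q / p) + q = q * (r / p + 1)"
            using q by (simp add: algebra_simps)
          then show ?thesis unfolding r(3) using q by simp
        qed
        have "A k epowr (q / p) = ennreal (2 powr (- real_of_int k * (r / q) * (q / p))) * (e k / 2) epowr (r * (q / p))"
          using q p by (simp only: A_def epowr_mult[of "q / p"] divide_pos_pos epowr_ennreal powr_ge_zero powr_powr epowr_epowr)
        then have "A k epowr (q / p) * (e k / 2) epowr q * ennreal (2 powr (- real_of_int k * 1))
          = (ennreal (2 powr (- real_of_int k * (r / q) * (q / p))) * ennreal (2 powr (- real_of_int k * 1)))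
            * ((e k / 2) epowr (r * (q / p)) * (e k / 2) epowr q)"
          by (simp only: mult_ac)
        also have "(e k / 2) epowr (r * (q / p)) * (e k / 2) epowr q = (e k / 2) epowr r"
          using epowr_add[of "r * (q / p)" q "e k / 2"] r(1) q p unfolding ex2 by simp
        also have "ennreal (2 powr (- real_of_int k * (r / q) * (q / p))) * ennreal (2 powr (- real_of_int k * 1))
          = ennreal (2 powr (- real_of_int k * (r / q)))"
          by (simp only: ennreal_mult[symmetric] powr_ge_zero powr_add[symmetric] ex)
        finally show ?thesis by (simp add: A_def)
      qed
      ultimately show ?thesis by simp
    qed
    have "S \<le> (\<Sum>k\<in>J. F y (initial k) epowr (q / a) * ennreal (2 powr (- real_of_int k * 1)))"
      unfolding S_def by (intro sum_mono AF)
    also have "\<dots> = (\<integral>\<^sup>+k. F y (initial k) epowr (q / a) * ennreal (2 powr (- real_of_int k * 1)) \<partial>count_space J)"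
      using J by (simp add: nn_integral_count_space_finite)
    also have "\<dots> \<le> (\<integral>\<^sup>+k. F y (initial k) epowr (q / a) * ennreal (2 powr (- real_of_int k * 1)) \<partial>count_space UNIV)"
      by (subst nn_integral_count_space_indicator) (auto intro!: nn_integral_mono simp: indicator_def)
    finally have "ennreal (2 powr - 1 * (1 - (3/4) powr 1)) * S \<le> ennreal (2 powr - 1 * (1 - (3/4) powr 1)) * \<dots>"
      by (intro mult_left_mono) auto
    also have "\<dots> \<le> (\<integral>\<^sup>+t. F y {0<..<t} epowr (q / a) \<partial>\<mu>)"
    proof (rule slices_le_nn_integral)
      show "(\<lambda>t. F y {0<..<t} epowr (q / a)) \<in> borel_measurable \<mu>"
        using F_Ioo_measurable_half_line[of "q / a" y] a q by (simp add: \<mu>_def)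
      show "F y (initial k) epowr (q / a) \<le> F y {0<..<t} epowr (q / a)" if "t \<in> slice (k + 1)" for k t
        using initial_subset_Ioo[OF that] a q by (intro epowr_mono F_mono) auto
      show "F y (initial k) epowr (q / a) = 0" if "initial k = {}" for k
        using that by (simp add: F_def nn_integral_restrict_space)
    qed (use sets_\<mu> emeasure_\<mu>_Ioc in auto)
    also have "\<dots> = ces y epowr q" by (simp add: ces_epowr)
    also have "\<dots> \<le> (C * G y {0<..} epowr (1 / p)) epowr q"
      using q G S_finite by (intro epowr_mono C y) (auto intro: order.strict_trans1)
    also have "\<dots> \<le> (C * S epowr (1 / p)) epowr q"
      using q p G by (intro epowr_mono mult_left_mono) auto
    \<comment> \<open>1/8 is the value of \<open>2 powr - \<rho> * (1 - (3/4) powr \<rho>)\<close>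
      at \<open>\<rho> = 1\<close>.\<close>
    finally have le: "ennreal (1 / 8) * S \<le> (C * S epowr (1 / p)) epowr q"
      by (simp add: powr_minus)
    obtain \<sigma> where \<sigma>: "S = ennreal \<sigma>" "0 \<le> \<sigma>" using S_finite by (cases S) auto
    show ?thesis
    proof (cases "\<sigma> = 0")
      case True
      then show ?thesis using \<sigma> by (simp add: S_def[symmetric])
    next
      case False
      with \<sigma> have \<sigma>_pos: "0 < \<sigma>" by simp
      have "(C * S epowr (1 / p)) epowr q = ennreal (\<gamma> powr q * \<sigma> powr (q / p))"
        using \<gamma> \<sigma> q by (simp add: epowr_mult epowr_epowr epowr_ennreal ennreal_mult powr_powr)
      then have "ennreal (1 / 8 * \<sigma>) \<le> ennreal (\<gamma> powr q * \<sigma> powr (q / p))"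
        using le \<sigma> by (simp add: ennreal_mult[symmetric])
      then have "1 / 8 * \<sigma> \<le> \<gamma> powr q * \<sigma> powr (q / p)"
        by (subst (asm) ennreal_le_iff) auto
      \<comment> \<open>\<open>q / r + q / p = 1\<close>; the split isolates the factor to be
        cancelled.\<close>
      moreover have "\<sigma> = \<sigma> powr (q / r) * \<sigma> powr (q / p)"
        using \<sigma>_pos r(2) by (simp flip: powr_add)
      ultimately have "\<sigma> powr (q / r) * \<sigma> powr (q / p) \<le> 8 * \<gamma> powr q * \<sigma> powr (q / p)"
        by linarith
      then have "\<sigma> powr (q / r) \<le> 8 * \<gamma> powr q"
        using \<sigma>_pos by simp
      then have "(\<sigma> powr (q / r)) powr (r / q) \<le> (8 * \<gamma> powr q) powr (r / q)"
        using stieltjes_h(1) by (intro powr_mono2) auto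
      then have "\<sigma> \<le> 8 powr (r / q) * \<gamma> powr r"
        using \<sigma>_pos r(1) q by (simp add: powr_powr powr_mult)
      then show ?thesis using \<sigma> by (simp add: S_def[symmetric] ennreal_leI)
    qed
  qed
  have "(\<integral>\<^sup>+t. V t epowr r \<partial>stieltjes h)
      \<le> (\<integral>\<^sup>+k. e k epowr r * ennreal (2 powr (r / q) * 2 powr (- real_of_int k * (r / q))) \<partial>count_space UNIV)"
  proof (rule nn_integral_le_slices[OF stieltjes_h V_epowr_measurable])
    show "V t epowr r \<le> e k epowr r" if "t \<in> slice k" for k t
      unfolding V_def e_def using r Ioo_subset_initial[OF that]
      by (intro epowr_mono Lnorm_mono_set measurable_restrict_mono[OF w])
        (auto simp: borel_lebesgue initial_subset)
  qed
  also have "\<dots> = (\<integral>\<^sup>+k. ennreal (2 powr (r / q) * 2 powr r) * A k \<partial>count_space UNIV)"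
  proof (rule nn_integral_cong)
    fix k
    have "e k = 2 * (e k / 2)"
      using mult_divide_eq_ennreal[of 2 "e k"] by (simp add: ennreal_times_divide mult.commute[of 2])
    then have "e k epowr r = ennreal (2 powr r) * (e k / 2) epowr r"
      using r epowr_mult[of r 2 "e k / 2"] epowr_ennreal[of 2 r] by simp
    then show "e k epowr r * ennreal (2 powr (r / q) * 2 powr (- real_of_int k * (r / q)))
        = ennreal (2 powr (r / q) * 2 powr r) * A k"
      unfolding A_def by (simp only: ennreal_mult[OF powr_ge_zero powr_ge_zero] mult_ac)
  qed
  also have "\<dots> = ennreal (2 powr (r / q) * 2 powr r) * (\<integral>\<^sup>+k. A k \<partial>count_space UNIV)"
    by (rule nn_integral_cmult) simp
  also have "\<dots> \<le> ennreal (2 powr (r / q) * 2 powr r) * ennreal (8 powr (r / q) * \<gamma> powr r)"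
    by (intro mult_left_mono nn_integral_int_le sum_A) auto
  also have "\<dots> = (ennreal ((2 powr (r / q) * 2 powr r * 8 powr (r / q)) powr (1 / r)) * C) epowr r"
    using \<gamma> r by (simp add: epowr_mult epowr_ennreal powr_powr ennreal_mult mult.assoc)
  finally show ?thesis using r by (simp add: epowr_inverse_le_iff)
qed

end

end

section \<open>The embedding\<close>

lemma Lnorm_cong_AE:
  assumes "p \<noteq> \<infinity>" "AE x in lebesgue_on A. f x = g x"
  shows "Lnorm p A f = Lnorm p A g"
proof -
  have "AE x in lebesgue_on A. f x epowr enn2real p = g x epowr enn2real p"
    using assms(2) by eventually_elim simp
  then show ?thesis
    using assms(1) by (simp add: Lnorm_def nn_integral_cong_AE)
qed

lemma Ces_norm_cong_AE:
  assumes "p \<noteq> \<infinity>" "AE x in half_line. f x * v x = g x * w x"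
  shows "Ces_norm p q u v f = Ces_norm p q u w g"
proof -
  have "Lnorm_w p v {0<..<t} f = Lnorm_w p w {0<..<t} g" for t
    unfolding Lnorm_w_def
  proof (rule Lnorm_cong_AE[OF assms(1)])
    show "AE x in lebesgue_on {0<..<t}. f x * v x = g x * w x"
      using assms(2)
      by (subst AE_restrict_space_iff, simp, subst (asm) AE_restrict_space_iff) (auto elim!: eventually_mono)
  qed
  then show ?thesis by (simp add: Ces_norm_def)
qed

lemma Lnorm_Ioo_measurable:
  assumes "u \<in> pos_meas"
  shows "(\<lambda>x. Lnorm p {0<..<x} u) \<in> borel_measurable half_line"
proof -
  have "(\<lambda>x. Lnorm p {0<..<x} u) \<in> borel_measurable borel"
  proof (intro borel_measurable_mono_ennreal monoI)
    fix b c :: real assume "b \<le> c"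
    then show "Lnorm p {0<..<b} u \<le> Lnorm p {0<..<c} u"
      using assms unfolding pos_meas_def
      by (intro Lnorm_mono_set) (auto elim: measurable_restrict_mono)
  qed
  then show ?thesis
    by (intro measurable_restrict_space1 measurable_completion) simp
qed

lemma Cop_norm_eq:
  assumes p: "0 < p" and u: "u \<in> pos_meas" and v: "v \<in> pos_meas" and f: "f \<in> pos_meas"
  shows "Cop_norm (ennreal p) (ennreal p) u v f
    = Lnorm (ennreal p) {0<..} (\<lambda>x. f x * v x * Lnorm (ennreal p) {0<..<x} u)"
proof -
  interpret sigma_finite_measure half_line by (rule sigma_finite_lebesgue_on) simp
  interpret pair_sigma_finite half_line half_line ..
  define \<phi> where "\<phi> x = (f x * v x) epowr p" for x
  have [measurable]: "u \<in> borel_measurable half_line" "\<phi> \<in> borel_measurable half_line"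
    using u v f unfolding pos_meas_def \<phi>_def by measurable
  note id_half_line [measurable]
  have "(Lnorm (ennreal p) {t<..} (\<lambda>x. f x * v x) * u t) epowr p
      = (\<integral>\<^sup>+x. \<phi> x * indicator {t<..} x * u t epowr p \<partial>half_line)" if "0 < t" for t
  proof -
    have "(\<integral>\<^sup>+x. \<phi> x \<partial>lebesgue_on {t<..}) = (\<integral>\<^sup>+x. \<phi> x * indicator {t<..} x \<partial>half_line)"
      using that by (intro nn_integral_lebesgue_on_subset) auto
    moreover have "(\<lambda>x. \<phi> x * indicator {t<..} x) \<in> borel_measurable half_line"
      by (intro borel_measurable_times_ennreal borel_measurable_indicator_lebesgue_on) auto
    ultimately show ?thesis
      using p by (simp add: Lnorm_ennreal epowr_mult epowr_epowr \<phi>_def[symmetric] nn_integral_multc)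
  qed
  then have "(\<integral>\<^sup>+t. (Lnorm (ennreal p) {t<..} (\<lambda>x. f x * v x) * u t) epowr p \<partial>half_line)
      = (\<integral>\<^sup>+t. \<integral>\<^sup>+x. \<phi> x * indicator {t<..} x * u t epowr p \<partial>half_line \<partial>half_line)"
    by (intro nn_integral_cong) (simp add: space_restrict_space)
  also have "\<dots> = (\<integral>\<^sup>+x. \<integral>\<^sup>+t. \<phi> x * indicator {t<..} x * u t epowr p \<partial>half_line \<partial>half_line)"
    by (intro Fubini') (simp add: indicator_def case_prod_beta')
  also have "\<dots> = (\<integral>\<^sup>+x. (f x * v x * Lnorm (ennreal p) {0<..<x} u) epowr p \<partial>half_line)"
  proof (rule nn_integral_cong)
    fix x :: real assume "x \<in> space half_line"
    then have x: "0 < x" by (simp add: space_restrict_space)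
    have "(\<integral>\<^sup>+t. \<phi> x * indicator {t<..} x * u t epowr p \<partial>half_line)
        = (\<integral>\<^sup>+t. \<phi> x * (u t epowr p * indicator {0<..<x} t) \<partial>half_line)"
      by (intro nn_integral_cong) (auto simp: indicator_def space_restrict_space)
    also have "\<dots> = \<phi> x * (\<integral>\<^sup>+t. u t epowr p * indicator {0<..<x} t \<partial>half_line)"
      by (intro nn_integral_cmult borel_measurable_times_ennreal borel_measurable_indicator_lebesgue_on) auto
    also have "(\<integral>\<^sup>+t. u t epowr p * indicator {0<..<x} t \<partial>half_line) = (\<integral>\<^sup>+t. u t epowr p \<partial>lebesgue_on {0<..<x})"
      by (intro nn_integral_lebesgue_on_subset[symmetric]) auto
    finally show "(\<integral>\<^sup>+t. \<phi> x * indicator {t<..} x * u t epowr p \<partial>half_line)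
        = (f x * v x * Lnorm (ennreal p) {0<..<x} u) epowr p"
      using p by (simp add: Lnorm_ennreal epowr_mult epowr_epowr \<phi>_def)
  qed
  finally show ?thesis
    using p by (simp add: Cop_norm_def Lnorm_w_def Lnorm_ennreal)
qed

locale Cop_Ces_embedding =
  fixes a p q K :: real and v1 v2 u1 u2 :: "real \<Rightarrow> ennreal"
  assumes exponents: "0 < a" "a \<le> p" "0 < q"
    and K_pos: "0 < K"
    and Hardy_K: "\<And>B :: int \<Rightarrow> ennreal.
      (\<integral>\<^sup>+k. ennreal (2 powr - real_of_int k) * (\<integral>\<^sup>+j. B j \<partial>count_space {..k}) epowr (q / a) \<partial>count_space UNIV)
        \<le> ennreal K * (\<integral>\<^sup>+k. ennreal (2 powr - real_of_int k) * B k epowr (q / a) \<partial>count_space UNIV)"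
    and v1: "v1 \<in> weights" and v2: "v2 \<in> weights"
    and u1: "u1 \<in> cOmega (ennreal p)" and u2: "u2 \<in> Omega (ennreal q)"
begin

definition U :: "real \<Rightarrow> ennreal" where "U x = Lnorm (ennreal p) {0<..<x} u1"

definition w :: "real \<Rightarrow> ennreal" where "w x = inverse (U x) * (inverse (v1 x) * v2 x)"

abbreviation best :: ennreal where
  "best \<equiv> best_const (Cop (ennreal p) (ennreal p) u1 v1) (Cop_norm (ennreal p) (ennreal p) u1 v1)
    (Ces_norm (ennreal a) (ennreal q) u2 v2)"

lemma measurable [measurable]:
  "v1 \<in> borel_measurable half_line" "v2 \<in> borel_measurable half_line" "U \<in> borel_measurable half_line"
  "u1 \<in> borel_measurable half_line" "u2 \<in> borel_measurable half_line"
  using v1 v2 u1 u2 Lnorm_Ioo_measurable[of u1]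
  by (auto simp: weights_def cOmega_def Omega_def pos_meas_def U_def[abs_def])

text \<open>The substitution \<open>y = f * v1 * U\<close> has to be undone, and in [0,\<infinity>]
  a product with the inverse equals 1 only at positive finite values. For \<open>v1\<close> these
  come from being a weight, for \<open>U\<close> from \<open>u1\<close> being in
  \<open>cOmega\<close>.\<close>

lemma AE_cancel: "AE x in half_line. v1 x * inverse (v1 x) = 1 \<and> U x * inverse (U x) = 1"
proof -
  have "AE x in half_line. 0 < x" by (intro AE_I2) (simp add: space_restrict_space)
  moreover have "AE x in half_line. 0 < v1 x \<and> v1 x < \<infinity>" using v1 by (simp add: weights_def)
  ultimately show ?thesis
  proof eventually_elim
    case (elim x)
    then have "0 < U x \<and> U x < \<infinity>" using u1 by (simp add: cOmega_def U_def)
    with elim show ?case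
      by (simp add: divide_ennreal_def[symmetric] ennreal_divide_self zero_less_iff_neq_zero)
  qed
qed

sublocale weighted_Hardy a p q K w u2
proof
  show "w \<in> borel_measurable half_line" unfolding w_def by measurable
  show "0 < (\<integral>\<^sup>+x. u2 x epowr q \<partial>lebesgue_on {t<..}) \<and> (\<integral>\<^sup>+x. u2 x epowr q \<partial>lebesgue_on {t<..}) < \<infinity>" if "0 < t" for t
  proof -
    have "0 < Lnorm (ennreal q) {t<..} u2 \<and> Lnorm (ennreal q) {t<..} u2 < \<infinity>"
      using u2 that by (simp add: Omega_def)
    then show ?thesis
      using exponents by (simp add: Lnorm_ennreal zero_less_iff_neq_zero)
  qed
qed (use exponents K_pos Hardy_K in auto)

lemma V_eq: "V t = Lnorm_w (ennreal p \<leadsto> ennreal a) (\<lambda>x. inverse (v1 x) * v2 x) {0<..<t}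
    (\<lambda>x. inverse (Lnorm (ennreal p) {0<..<x} u1))"
  unfolding V_def s_def Lnorm_w_def w_def U_def ..

lemma Cop_norm_G:
  assumes "f \<in> pos_meas"
  shows "Cop_norm (ennreal p) (ennreal p) u1 v1 f = G (\<lambda>x. f x * v1 x * U x) {0<..} epowr (1 / p)"
  using assms exponents u1 v1 by (simp add: Cop_norm_eq cOmega_def weights_def U_def G_def Lnorm_ennreal)

lemma best_le:
  assumes "\<And>y. y \<in> borel_measurable half_line \<Longrightarrow> ces y \<le> c * G y {0<..} epowr (1 / p)"
  shows "best \<le> c"
  unfolding best_const_def
proof (rule Inf_lower, safe)
  fix f assume "f \<in> Cop (ennreal p) (ennreal p) u1 v1"
  then have f: "f \<in> pos_meas" by (simp add: Cop_def)
  then have [measurable]: "f \<in> borel_measurable half_line" by (simp add: pos_meas_def)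
  let ?y = "\<lambda>x. f x * v1 x * U x"
  have "AE x in half_line. f x * v2 x = ?y x * w x"
    using AE_cancel
  proof eventually_elim
    case (elim x)
    have "?y x * w x = f x * v2 x * (v1 x * inverse (v1 x)) * (U x * inverse (U x))"
      by (simp add: w_def mult_ac)
    then show ?case using elim by simp
  qed
  then have "Ces_norm (ennreal a) (ennreal q) u2 v2 f = ces ?y"
    unfolding ces_def by (intro Ces_norm_cong_AE) auto
  also have "\<dots> \<le> c * G ?y {0<..} epowr (1 / p)"
    by (rule assms) measurable
  finally show "Ces_norm (ennreal a) (ennreal q) u2 v2 f \<le> c * Cop_norm (ennreal p) (ennreal p) u1 v1 f"
    by (simp add: Cop_norm_G[OF f])
qed

text \<open>Each \<open>y\<close> with \<open>G y {0<..}\<close> finite comes, up to a null set,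
  from a function in \<open>Cop\<close>, so every admissible constant of the embedding satisfies the
  Hardy inequality for these \<open>y\<close>. An infinite \<open>G y {0<..}\<close> would lead
  outside \<open>Cop\<close>, hence the restriction.\<close>

lemma best_ge:
  assumes "\<And>c. (\<And>y. y \<in> borel_measurable half_line \<Longrightarrow> G y {0<..} < \<infinity> \<Longrightarrow> ces y \<le> c * G y {0<..} epowr (1 / p)) \<Longrightarrow> D \<le> c"
  shows "D \<le> best"
  unfolding best_const_def
proof (rule Inf_greatest, safe)
  fix c assume c: "\<forall>f\<in>Cop (ennreal p) (ennreal p) u1 v1.
      Ces_norm (ennreal a) (ennreal q) u2 v2 f \<le> c * Cop_norm (ennreal p) (ennreal p) u1 v1 f"
  show "D \<le> c"
  proof (rule assms)
    fix y assume y [measurable]: "y \<in> borel_measurable half_line" and G: "G y {0<..} < \<infinity>"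
    define f where "f x = y x * inverse (U x) * inverse (v1 x)" for x
    have f: "f \<in> pos_meas" unfolding f_def pos_meas_def by measurable
    have "AE x in half_line. f x * v1 x * U x = y x"
      using AE_cancel
    proof eventually_elim
      case (elim x)
      have "f x * v1 x * U x = y x * (v1 x * inverse (v1 x)) * (U x * inverse (U x))"
        by (simp add: f_def mult_ac)
      then show ?case using elim by simp
    qed
    then have "AE x in half_line. (f x * v1 x * U x) epowr p = y x epowr p"
      by eventually_elim simp
    then have "G (\<lambda>x. f x * v1 x * U x) {0<..} = G y {0<..}"
      unfolding G_def by (rule nn_integral_cong_AE)
    then have Cop: "Cop_norm (ennreal p) (ennreal p) u1 v1 f = G y {0<..} epowr (1 / p)"
      by (simp add: Cop_norm_G[OF f])
    then have "Cop_norm (ennreal p) (ennreal p) u1 v1 f < \<infinity>"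
      using G by simp
    then have "Ces_norm (ennreal a) (ennreal q) u2 v2 f \<le> c * Cop_norm (ennreal p) (ennreal p) u1 v1 f"
      using c f by (simp add: Cop_def)
    moreover have "Ces_norm (ennreal a) (ennreal q) u2 v2 f = ces y"
      unfolding ces_def by (intro Ces_norm_cong_AE) (auto simp: f_def w_def mult_ac)
    ultimately show "ces y \<le> c * G y {0<..} epowr (1 / p)" by (simp add: Cop)
  qed
qed

end

lemma approx_byI:
  assumes "0 < c" "ennreal b * A \<ge> B" "b \<le> c" "A \<le> ennreal b' * B" "b' \<le> c"
  shows "approx_by c A B"
  unfolding approx_by_def
proof
  have "inverse (ennreal c) * B \<le> inverse (ennreal c) * (ennreal c * A)"
    using assms by (intro mult_left_mono order_trans[OF assms(2)] mult_right_mono ennreal_leI) auto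
  also have "\<dots> = A"
    using assms(1) by (simp add: mult.assoc[symmetric] ennreal_inverse_mult inverse_ennreal flip: ennreal_mult)
  finally show "inverse (ennreal c) * B \<le> A" .
  show "A \<le> ennreal c * B"
    using assms by (intro order_trans[OF assms(4)] mult_right_mono ennreal_leI) auto
qed

theorem theorem7p3:
  fixes p1 p2 q1 q2 :: ennreal
  assumes "0 < p1" "p1 < \<infinity>" "0 < p2" "p2 < \<infinity>"
    and "0 < q1" "q1 < \<infinity>" "0 < q2" "q2 < \<infinity>"
    and "p1 = q1" "p2 \<noteq> q2" "p2 \<le> p1"
  shows "(p1 \<le> q2 \<longrightarrow>
      (\<exists>c>0. \<forall>v1\<in>weights. \<forall>v2\<in>weights. \<forall>u1\<in>cOmega q1. \<forall>u2\<in>Omega q2.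
        let v = (\<lambda>x. inverse (v1 x) * v2 x) in
        approx_by c
          (best_const (Cop p1 q1 u1 v1) (Cop_norm p1 q1 u1 v1) (Ces_norm p2 q2 u2 v2))
          (SUP t\<in>{0<..}.
             Lnorm_w (p1 \<leadsto> p2) v {0<..<t} (\<lambda>x. inverse (Lnorm p1 {0<..<x} u1))
             * Lnorm q2 {t<..} u2)))
    \<and> (q2 < p1 \<longrightarrow>
      (\<exists>c>0. \<forall>v1\<in>weights. \<forall>v2\<in>weights. \<forall>u1\<in>cOmega q1. \<forall>u2\<in>Omega q2.
        let v = (\<lambda>x. inverse (v1 x) * v2 x); r = enn2real (p1 \<leadsto> q2) in
        approx_by c
          (best_const (Cop p1 q1 u1 v1) (Cop_norm p1 q1 u1 v1) (Ces_norm p2 q2 u2 v2))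
          ((\<integral>\<^sup>+t. Lnorm_w (p1 \<leadsto> p2) v {0<..<t} (\<lambda>x. inverse (Lnorm p1 {0<..<x} u1)) epowr r
              \<partial>stieltjes (\<lambda>t. - enn2real (Lnorm q2 {t<..} u2 epowr r))) epowr (1 / r))))"
proof (intro conjI impI)
  define a where "a = enn2real p2"
  define p where "p = enn2real p1"
  define q where "q = enn2real q2"
  have eq: "p2 = ennreal a" "p1 = ennreal p" "q1 = ennreal p" "q2 = ennreal q"
    using assms by (simp_all add: a_def p_def q_def)
  have apq: "0 < a" "a \<le> p" "0 < q"
    using assms by (auto simp: a_def p_def q_def enn2real_positive_iff intro: enn2real_mono)
  have "0 < q / a" using apq by simp
  then obtain K where K: "0 < K" "\<And>B :: int \<Rightarrow> ennreal.
      (\<integral>\<^sup>+k. ennreal (2 powr - real_of_int k) * (\<integral>\<^sup>+j. B j \<partial>count_space {..k}) epowr (q / a) \<partial>count_space UNIV)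
        \<le> ennreal K * (\<integral>\<^sup>+k. ennreal (2 powr - real_of_int k) * B k epowr (q / a) \<partial>count_space UNIV)"
    by (rule discrete_Hardy) blast
  have emb: "Cop_Ces_embedding a p q K v1 v2 u1 u2"
    if "v1 \<in> weights" "v2 \<in> weights" "u1 \<in> cOmega q1" "u2 \<in> Omega q2" for v1 v2 u1 u2
    using that apq K unfolding eq by unfold_locales auto
  show "\<exists>c>0. \<forall>v1\<in>weights. \<forall>v2\<in>weights. \<forall>u1\<in>cOmega q1. \<forall>u2\<in>Omega q2.
        let v = (\<lambda>x. inverse (v1 x) * v2 x) in
        approx_by c
          (best_const (Cop p1 q1 u1 v1) (Cop_norm p1 q1 u1 v1) (Ces_norm p2 q2 u2 v2))
          (SUP t\<in>{0<..}.
             Lnorm_w (p1 \<leadsto> p2) v {0<..<t} (\<lambda>x. inverse (Lnorm p1 {0<..<x} u1))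
             * Lnorm q2 {t<..} u2)"
    if "p1 \<le> q2"
  \<comment> \<open>The lower bound holds with constant 1, the upper bound with
    \<open>(4 * K) powr (1 / q)\<close>.\<close>
  proof (intro exI[of _ "max 1 ((4 * K) powr (1 / q))"] conjI ballI)
    fix v1 v2 u1 u2
    assume "v1 \<in> weights" "v2 \<in> weights" "u1 \<in> cOmega q1" "u2 \<in> Omega q2"
    then interpret Cop_Ces_embedding a p q K v1 v2 u1 u2 by (rule emb)
    define D where "D = (SUP t\<in>{0<..}. V t * ennreal (n t powr (1 / q)))"
    have D: "(SUP t\<in>{0<..}. Lnorm_w (p1 \<leadsto> p2) (\<lambda>x. inverse (v1 x) * v2 x) {0<..<t}
        (\<lambda>x. inverse (Lnorm p1 {0<..<x} u1)) * Lnorm q2 {t<..} u2) = D"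
      unfolding D_def by (intro SUP_cong) (simp_all add: V_eq eq Lnorm_u)
    have "p \<le> q" using that apq by (simp add: eq)
    then have "best \<le> ennreal ((4 * K) powr (1 / q)) * D"
      by (intro best_le ces_le_Sup) (auto simp: D_def intro: SUP_upper)
    moreover have "D \<le> best"
      unfolding D_def by (intro best_ge SUP_least V_mult_le) auto
    ultimately show "let v = (\<lambda>x. inverse (v1 x) * v2 x) in
        approx_by (max 1 ((4 * K) powr (1 / q)))
          (best_const (Cop p1 q1 u1 v1) (Cop_norm p1 q1 u1 v1) (Ces_norm p2 q2 u2 v2))
          (SUP t\<in>{0<..}.
             Lnorm_w (p1 \<leadsto> p2) v {0<..<t} (\<lambda>x. inverse (Lnorm p1 {0<..<x} u1))
             * Lnorm q2 {t<..} u2)"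
      unfolding Let_def D by (intro approx_byI[where b = 1 and b' = "(4 * K) powr (1 / q)"]) (simp_all add: eq)
  qed simp
  show "\<exists>c>0. \<forall>v1\<in>weights. \<forall>v2\<in>weights. \<forall>u1\<in>cOmega q1. \<forall>u2\<in>Omega q2.
        let v = (\<lambda>x. inverse (v1 x) * v2 x); r = enn2real (p1 \<leadsto> q2) in
        approx_by c
          (best_const (Cop p1 q1 u1 v1) (Cop_norm p1 q1 u1 v1) (Ces_norm p2 q2 u2 v2))
          ((\<integral>\<^sup>+t. Lnorm_w (p1 \<leadsto> p2) v {0<..<t} (\<lambda>x. inverse (Lnorm p1 {0<..<x} u1)) epowr r
              \<partial>stieltjes (\<lambda>t. - enn2real (Lnorm q2 {t<..} u2 epowr r))) epowr (1 / r))"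
    if "q2 < p1"
  proof -
    have qp: "q < p" using that apq by (simp add: eq ennreal_less_iff)
    define r where "r = 1 / (1 / q - 1 / p)"
    have r: "0 < r" "enn2real (p1 \<leadsto> q2) = r"
      using qp apq arrow_less[of q p] by (auto simp: r_def eq field_simps)
    define b where "b = (2 powr (r / q) * 2 powr r * 8 powr (r / q)) powr (1 / r)"
    define b' where "b' = (2 * K) powr (1 / q) * (1 / (2 powr - (r / q) * (1 - (3/4) powr (r / q)))) powr (1 / r)"
    show ?thesis
    proof (intro exI[of _ "max 1 (max b b')"] conjI ballI)
      fix v1 v2 u1 u2
      assume "v1 \<in> weights" "v2 \<in> weights" "u1 \<in> cOmega q1" "u2 \<in> Omega q2"
      then interpret E: Cop_Ces_embedding a p q K v1 v2 u1 u2 by (rule emb)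
      have Er: "E.r = r" by (simp add: E.r_def r_def)
      have h: "(\<lambda>t. - enn2real (Lnorm q2 {t<..} u2 epowr r)) = E.h"
        by (simp add: E.h_def[abs_def] Er eq)
      define D where "D = (\<integral>\<^sup>+t. E.V t epowr r \<partial>stieltjes E.h) epowr (1 / r)"
      have D: "(\<integral>\<^sup>+t. Lnorm_w (p1 \<leadsto> p2) (\<lambda>x. inverse (v1 x) * v2 x) {0<..<t} (\<lambda>x. inverse (Lnorm p1 {0<..<x} u1)) epowr r
            \<partial>stieltjes (\<lambda>t. - enn2real (Lnorm q2 {t<..} u2 epowr r))) epowr (1 / r) = D"
        unfolding D_def h by (simp add: E.V_eq eq)
      have "E.best \<le> ennreal b' * D"
        using E.ces_le_stieltjes[OF qp] unfolding b'_def D_def Er by (rule E.best_le)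
      moreover have "D \<le> ennreal b * E.best"
      proof -
        have b: "0 < b" by (simp add: b_def)
        have inv: "ennreal (inverse b) * ennreal b = 1" "ennreal b * ennreal (inverse b) = 1"
          using b by (simp_all flip: ennreal_mult)
        \<comment> \<open>\<open>best_ge\<close> compares a fixed quantity with every admissible
          constant, so the factor \<open>b\<close> is first moved to the side of \<open>D\<close>
          and returned afterwards.\<close>
        have "ennreal (inverse b) * D \<le> E.best"
        proof (rule E.best_ge)
          fix c assume "\<And>y. y \<in> borel_measurable half_line \<Longrightarrow> E.G y {0<..} < \<infinity> \<Longrightarrow> E.ces y \<le> c * E.G y {0<..} epowr (1 / p)"
          from E.stieltjes_le[OF qp this] have "D \<le> ennreal b * c"
            unfolding b_def D_def Er .
          then have "ennreal (inverse b) * D \<le> ennreal (inverse b) * (ennreal b * c)"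
            by (intro mult_left_mono) auto
          then show "ennreal (inverse b) * D \<le> c"
            by (simp only: mult.assoc[symmetric] inv mult_1_left)
        qed
        then have "ennreal b * (ennreal (inverse b) * D) \<le> ennreal b * E.best"
          by (intro mult_left_mono) auto
        then show ?thesis
          by (simp only: mult.assoc[symmetric] inv mult_1_left)
      qed
      ultimately show "let v = (\<lambda>x. inverse (v1 x) * v2 x); r = enn2real (p1 \<leadsto> q2) in
        approx_by (max 1 (max b b'))
          (best_const (Cop p1 q1 u1 v1) (Cop_norm p1 q1 u1 v1) (Ces_norm p2 q2 u2 v2))
          ((\<integral>\<^sup>+t. Lnorm_w (p1 \<leadsto> p2) v {0<..<t} (\<lambda>x. inverse (Lnorm p1 {0<..<x} u1)) epowr r
              \<partial>stieltjes (\<lambda>t. - enn2real (Lnorm q2 {t<..} u2 epowr r))) epowr (1 / r))"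
        unfolding Let_def r(2) D by (intro approx_byI[where b = b and b' = b']) (simp_all add: eq)
    qed simp
  qed
qed

end
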